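(* For every integer $k\geq 2$, there exists a family $(D_i)_{i\in\mathbb{N}}$ of directed graphs of treewidth (at most) $k$ such that $n(D_i)=k+2+i(k+1)$ and $f(D_i)\geq (i+1)\bigl(k-2\lfloor\log_2(k)\rfloor\bigr)$.
   Context: Directed graphs are oriented graphs: finite, no loops, no multiple arcs and no pair of antiparallel arcs. $n(D)$ is the number of vertices and $f(D)$ is the minimum size of a set $F\subseteq V(D)$ such that $D-F$ contains no directed cycle. An undirected graph is a $k$-tree if it has a vertex ordering $\phi$ such that, for each vertex $v$, the set of neighbours of $v$ preceding it is a clique of size exactly $\min(k,\phi(v)-1)$. A (directed) graph has treewidth $k$ if its underlying undirected graph is a subgraph of a $k$-tree. $\mathbb{N}=\{0,1,2,\dots\}$. *)

theory Defs
  imports Complex_Main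
begin

definition oriented_graph :: "nat set \<Rightarrow> (nat \<times> nat) set \<Rightarrow> bool" where
  "oriented_graph V A \<longleftrightarrow> finite V \<and> A \<subseteq> V \<times> V
     \<and> (\<forall>v. (v, v) \<notin> A) \<and> (\<forall>u v. (u, v) \<in> A \<longrightarrow> (v, u) \<notin> A)"

definition is_fvs :: "nat set \<Rightarrow> (nat \<times> nat) set \<Rightarrow> nat set \<Rightarrow> bool" where
  "is_fvs V A F \<longleftrightarrow> F \<subseteq> V \<and> acyclic (A \<inter> ((V - F) \<times> (V - F)))"

definition fvs_num :: "nat set \<Rightarrow> (nat \<times> nat) set \<Rightarrow> nat" where
  "fvs_num V A = Min (card ` {F. is_fvs V A F})"

definition undirected_graph :: "nat set \<Rightarrow> (nat \<times> nat) set \<Rightarrow> bool" where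
  "undirected_graph V E \<longleftrightarrow> finite V \<and> E \<subseteq> V \<times> V
     \<and> (\<forall>v. (v, v) \<notin> E) \<and> (\<forall>u v. (u, v) \<in> E \<longrightarrow> (v, u) \<in> E)"

definition is_ktree :: "nat \<Rightarrow> nat set \<Rightarrow> (nat \<times> nat) set \<Rightarrow> bool" where
  "is_ktree k V E \<longleftrightarrow> undirected_graph V E \<and>
     (\<exists>\<phi>. bij_betw \<phi> V {1..card V} \<and>
        (\<forall>v\<in>V. let P = {u \<in> V. (u, v) \<in> E \<and> \<phi> u < \<phi> v} in
            (\<forall>x\<in>P. \<forall>y\<in>P. x \<noteq> y \<longrightarrow> (x, y) \<in> E) \<and> card P = min k (\<phi> v - 1)))"

definition underlying :: "(nat \<times> nat) set \<Rightarrow> (nat \<times> nat) set" where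
  "underlying A = {(u, v). (u, v) \<in> A \<or> (v, u) \<in> A}"

definition treewidth_le :: "nat \<Rightarrow> nat set \<Rightarrow> (nat \<times> nat) set \<Rightarrow> bool" where
  "treewidth_le k V A \<longleftrightarrow>
     (\<exists>V' E'. is_ktree k V' E' \<and> V \<subseteq> V' \<and> underlying A \<subseteq> E')"

end

theory Submission
  imports Defs
begin

text \<open>Let \<open>N = k + 1 \<le> 2 ^ m\<close> with \<open>m = \<lfloor>log 2 k\<rfloor> + 1\<close>. Subgraphs of the \<open>k\<close>-th power of a path have
  treewidth at most \<open>k\<close>, and orienting consecutive segments of the path independently makes the bounds
  on acyclic sets add up. It therefore suffices to orient a segment of \<open>N + 1\<close> vertices so that acyclic
  sets have at most \<open>2 m\<close> vertices, and a segment of \<open>2 N\<close> vertices so that they have at most \<open>4 m - 2\<close>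
  vertices. (A random tournament on \<open>N\<close> vertices only gives \<open>2 m\<close> instead of \<open>2 m - 1\<close>, which is why
  the segments are taken in pairs.) Both are first-moment arguments. Adding the vertices of \<open>S\<close> from left
  to right, a vertex with \<open>d\<close> earlier neighbours in \<open>S\<close> keeps \<open>S\<close> free of directed triangles with
  probability at most \<open>(1 + d) / 2 ^ d\<close>.

  For the segment of \<open>2 N\<close> vertices, the sets with \<open>a\<close> vertices in the first half and \<open>b\<close> in the second
  are sorted by the order in which their positions modulo \<open>N\<close> interleave. Second-half vertices are
  adjacent to the first-half vertices of larger position, so the sum over interleavings converges, while
  a fixed interleaving accounts for only about one in \<open>(a + b) choose a\<close> of all choices.\<close>

section \<open>Random orientations of powers of paths\<close>

definition triangle_free :: "(nat \<times> nat) set \<Rightarrow> nat set \<Rightarrow> bool" where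
  "triangle_free A S \<longleftrightarrow> \<not> (\<exists>x\<in>S. \<exists>y\<in>S. \<exists>z\<in>S. (x, y) \<in> A \<and> (y, z) \<in> A \<and> (z, x) \<in> A)"

text \<open>Earlier neighbours in the \<open>(N - 1)\<close>-st power of the path, in which any
  \<open>N\<close> consecutive vertices form a clique; \<open>N = k + 1\<close> at the end.\<close>

definition nbrs_before :: "nat \<Rightarrow> nat \<Rightarrow> nat set" where
  "nbrs_before N v = {u. u < v \<and> v < u + N}"

definition chain_ratio :: "nat \<Rightarrow> real" where
  "chain_ratio d = (1 + real d) / 2 ^ d"

lemma chain_ratio_pos: "chain_ratio d > 0"
  by (simp add: chain_ratio_def add_pos_nonneg)

lemma finite_nbrs_before [simp]: "finite (nbrs_before N v)"
  by (rule finite_subset[of _ "{..<v}"]) (auto simp: nbrs_before_def)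

lemma triangle_free_mono: "triangle_free A S \<Longrightarrow> B \<subseteq> A \<Longrightarrow> T \<subseteq> S \<Longrightarrow> triangle_free B T"
  unfolding triangle_free_def by blast

lemma acyclic_imp_triangle_free:
  assumes "acyclic (A \<inter> S \<times> S)"
  shows "triangle_free A S"
  unfolding triangle_free_def
proof
  let ?R = "A \<inter> S \<times> S"
  assume "\<exists>x\<in>S. \<exists>y\<in>S. \<exists>z\<in>S. (x, y) \<in> A \<and> (y, z) \<in> A \<and> (z, x) \<in> A"
  then obtain x y z where "(x, y) \<in> ?R" "(y, z) \<in> ?R" "(z, x) \<in> ?R" by blast
  then have "(x, x) \<in> ?R\<^sup>+" by (meson trancl.simps)
  with assms show False by (simp add: acyclic_def)
qed

text \<open>Comparable finite sets of equal size coincide, so a chain has at most one member of each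
  size from 0 to \<open>card C\<close>.\<close>

lemma card_chain_subsets_le:
  assumes "finite C" "\<And>Z. Z \<in> \<Z> \<Longrightarrow> Z \<subseteq> C"
    and chain: "\<And>X Y. X \<in> \<Z> \<Longrightarrow> Y \<in> \<Z> \<Longrightarrow> X \<subseteq> Y \<or> Y \<subseteq> X"
  shows "card \<Z> \<le> Suc (card C)"
proof -
  have fin: "finite Z" if "Z \<in> \<Z>" for Z using that assms(1,2) finite_subset by blast
  have "inj_on card \<Z>"
    by (rule inj_onI) (metis chain fin card_subset_eq)
  moreover have "card ` \<Z> \<subseteq> {..card C}"
    using assms(1,2) by (auto intro: card_mono)
  ultimately have "card \<Z> \<le> card {..card C}"
    by (intro card_inj_on_le) auto
  then show ?thesis by simp
qed

lemma card_trace_in_le: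
  assumes "finite B" "C \<subseteq> B" "\<Z> \<subseteq> Pow C"
  shows "card {Y \<in> Pow B. Y \<inter> C \<in> \<Z>} \<le> card \<Z> * 2 ^ (card B - card C)"
proof -
  have fin: "finite C" "finite (B - C)" "finite \<Z>"
    using assms finite_subset by (blast, blast, meson finite_Pow_iff finite_subset)
  have "card {Y \<in> Pow B. Y \<inter> C \<in> \<Z>} \<le> card (\<Z> \<times> Pow (B - C))"
  proof (rule card_inj_on_le[where f = "\<lambda>Y. (Y \<inter> C, Y - C)"])
    show "inj_on (\<lambda>Y. (Y \<inter> C, Y - C)) {Y \<in> Pow B. Y \<inter> C \<in> \<Z>}"
      by (rule inj_onI) blast
  qed (use fin in auto)
  also have "\<dots> = card \<Z> * 2 ^ (card B - card C)"
    using fin assms by (simp add: card_cartesian_product card_Pow card_Diff_subset)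
  finally show ?thesis .
qed

text \<open>If \<open>C\<close> carries a tournament, the possible in-neighbourhoods in \<open>C\<close> of a further vertex \<open>v\<close>
  are pairwise comparable when no triangle through \<open>v\<close> is allowed, so there are at most
  \<open>card C + 1\<close> of them.\<close>

lemma card_triangle_free_extensions_le:
  assumes "finite B" "C \<subseteq> B"
    and tour: "\<And>x y. x \<in> C \<Longrightarrow> y \<in> C \<Longrightarrow> x \<noteq> y \<Longrightarrow> (x, y) \<in> A \<or> (y, x) \<in> A"
  shows "card {Y \<in> Pow B. triangle_free (A \<union> Y \<times> {v} \<union> {v} \<times> (B - Y)) (insert v C)}
           \<le> Suc (card C) * 2 ^ (card B - card C)"
proof -
  \<comment> \<open>An arc from \<open>x\<close> in \<open>C - Z\<close> to \<open>y\<close> in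
    \<open>Z\<close> would close the triangle \<open>v\<close>, \<open>x\<close>,
    \<open>y\<close>.\<close>
  define \<Z> where "\<Z> = {Z. Z \<subseteq> C \<and> (\<forall>x\<in>C - Z. \<forall>y\<in>Z. (x, y) \<notin> A)}"
  have "card \<Z> \<le> Suc (card C)"
  proof (rule card_chain_subsets_le)
    show "finite C" using assms finite_subset by blast
    show "X \<subseteq> Y \<or> Y \<subseteq> X" if "X \<in> \<Z>" "Y \<in> \<Z>" for X Y
    proof (rule ccontr)
      assume "\<not> ?thesis"
      then obtain x y where "x \<in> X" "x \<notin> Y" "y \<in> Y" "y \<notin> X" by blast
      with that tour[of x y] show False unfolding \<Z>_def by blast
    qed
  qed (auto simp: \<Z>_def)
  moreover have "{Y \<in> Pow B. triangle_free (A \<union> Y \<times> {v} \<union> {v} \<times> (B - Y)) (insert v C)}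
      \<subseteq> {Y \<in> Pow B. Y \<inter> C \<in> \<Z>}"
    using assms(2) unfolding \<Z>_def triangle_free_def by blast
  then have "card {Y \<in> Pow B. triangle_free (A \<union> Y \<times> {v} \<union> {v} \<times> (B - Y)) (insert v C)}
      \<le> card {Y \<in> Pow B. Y \<inter> C \<in> \<Z>}"
    using assms(1) by (intro card_mono) auto
  moreover have "card {Y \<in> Pow B. Y \<inter> C \<in> \<Z>} \<le> card \<Z> * 2 ^ (card B - card C)"
    by (rule card_trace_in_le) (use assms in \<open>auto simp: \<Z>_def\<close>)
  ultimately show ?thesis
    by (meson le_trans mult_le_mono1)
qed

text \<open>Edges of the path power may stay without an arc, so that consecutive segments can be
  joined with no arcs between them.\<close>

definition path_power_orientation :: "nat \<Rightarrow> nat \<Rightarrow> (nat \<times> nat) set \<Rightarrow> bool" where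
  "path_power_orientation N n A \<longleftrightarrow>
     (\<forall>u v. (u, v) \<in> A \<longrightarrow> u < n \<and> v < n \<and> u < v + N \<and> v < u + N \<and> (v, u) \<notin> A)"

text \<open>Conditional expectations, one vertex at a time. The potential of \<open>S\<close> is the
  product of the factors of its unprocessed vertices, or 0 once its processed part contains a
  directed triangle.\<close>

lemma exists_orientation_few_triangle_free:
  assumes "finite \<F>" and fin: "\<And>S. S \<in> \<F> \<Longrightarrow> finite S"
  shows "\<exists>A. path_power_orientation N n A
      \<and> (\<forall>u v. u < v \<and> v < n \<and> v < u + N \<longrightarrow> (u, v) \<in> A \<or> (v, u) \<in> A)
      \<and> (\<Sum>S\<in>\<F>. if triangle_free A (S \<inter> {..<n})
                   then \<Prod>v\<in>S - {..<n}. chain_ratio (card (nbrs_before N v \<inter> S)) else 0)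
          \<le> (\<Sum>S\<in>\<F>. \<Prod>v\<in>S. chain_ratio (card (nbrs_before N v \<inter> S)))"
proof (induction n)
  case 0
  show ?case
    by (rule exI[of _ "{}"]) (simp add: path_power_orientation_def triangle_free_def)
next
  case (Suc n)
  define r where "r v S = chain_ratio (card (nbrs_before N v \<inter> S))" for v S
  define h where "h n A S = (if triangle_free A (S \<inter> {..<n}) then \<Prod>v\<in>S - {..<n}. r v S else 0)" for n A S
  have rpos: "r v S > 0" for v S by (simp add: r_def chain_ratio_pos)
  obtain A where A: "path_power_orientation N n A"
      "\<And>u v. u < v \<Longrightarrow> v < n \<Longrightarrow> v < u + N \<Longrightarrow> (u, v) \<in> A \<or> (v, u) \<in> A"
      "(\<Sum>S\<in>\<F>. h n A S) \<le> (\<Sum>S\<in>\<F>. \<Prod>v\<in>S. r v S)"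
    using Suc.IH unfolding h_def r_def by blast
  define B where "B = nbrs_before N n"
  have finB: "finite B" and Bn: "\<And>u. u \<in> B \<longleftrightarrow> u < n \<and> n < u + N"
    by (auto simp: B_def nbrs_before_def)
  \<comment> \<open>\<open>Y\<close> becomes the in-neighbourhood of \<open>n\<close>, the rest of
    \<open>B\<close> its out-neighbourhood.\<close>
  define E where "E Y = A \<union> Y \<times> {n} \<union> {n} \<times> (B - Y)" for Y
  \<comment> \<open>Averaged over all \<open>Y\<close>, the potential of each single
    \<open>S\<close> does not increase.\<close>
  have avg: "(\<Sum>Y\<in>Pow B. h (Suc n) (E Y) S) \<le> 2 ^ card B * h n A S" if S: "S \<in> \<F>" for S
  proof (cases "n \<in> S")
    case False
    then have "S \<inter> {..<Suc n} = S \<inter> {..<n}" "S - {..<Suc n} = S - {..<n}"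
      by (auto simp: less_Suc_eq)
    moreover have "triangle_free (E Y) (S \<inter> {..<n}) \<Longrightarrow> triangle_free A (S \<inter> {..<n})" for Y
      by (rule triangle_free_mono) (auto simp: E_def)
    ultimately have "h (Suc n) (E Y) S \<le> h n A S" for Y
      using rpos by (auto simp: h_def intro!: less_imp_le prod_pos)
    then have "(\<Sum>Y\<in>Pow B. h (Suc n) (E Y) S) \<le> (\<Sum>Y\<in>Pow B. h n A S)"
      by (intro sum_mono)
    then show ?thesis by (simp add: card_Pow finB)
  next
    case True
    define p where "p = (\<Prod>v\<in>S - {..<Suc n}. r v S)"
    define C where "C = B \<inter> S"
    have CB: "C \<subseteq> B" by (auto simp: C_def)
    have p0: "p \<ge> 0" using rpos by (auto simp: p_def intro!: less_imp_le prod_pos)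
    have "S - {..<n} = insert n (S - {..<Suc n})" using True by (auto simp: less_Suc_eq)
    then have hn: "h n A S = (if triangle_free A (S \<inter> {..<n}) then chain_ratio (card C) * p else 0)"
      using fin[OF S] by (simp add: h_def p_def r_def[of n] B_def C_def)
    show ?thesis
    proof (cases "triangle_free A (S \<inter> {..<n})")
      case False
      have "\<not> triangle_free (E Y) (S \<inter> {..<Suc n})" for Y
        using False by (rule contrapos_nn) (erule triangle_free_mono, auto simp: E_def)
      then have "h (Suc n) (E Y) S = 0" for Y by (simp add: h_def)
      then show ?thesis by (simp add: hn False)
    next
      case tf: True
      let ?G = "{Y \<in> Pow B. triangle_free (E Y) (insert n C)}"
      have "h (Suc n) (E Y) S \<le> (if triangle_free (E Y) (insert n C) then p else 0)" for Y
      proof -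
        have "insert n C \<subseteq> S \<inter> {..<Suc n}" using True by (auto simp: C_def Bn)
        then show ?thesis
          using triangle_free_mono[of "E Y" "S \<inter> {..<Suc n}" "E Y" "insert n C"] p0
          by (simp add: h_def p_def)
      qed
      then have "(\<Sum>Y\<in>Pow B. h (Suc n) (E Y) S)
          \<le> (\<Sum>Y\<in>Pow B. if triangle_free (E Y) (insert n C) then p else 0)"
        by (intro sum_mono)
      also have "\<dots> = (\<Sum>Y\<in>?G. p)"
        using finB by (subst sum.inter_filter) auto
      also have "\<dots> = real (card ?G) * p"
        by simp
      also have "\<dots> \<le> real (Suc (card C) * 2 ^ (card B - card C)) * p"
      proof (intro mult_right_mono p0)
        \<comment> \<open>Vertices of \<open>B\<close> are less than \<open>N\<close> apart, so
          \<open>C\<close> carries a tournament and the chain count applies.\<close>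
        have "(x, y) \<in> A \<or> (y, x) \<in> A" if "x \<in> C" "y \<in> C" "x \<noteq> y" for x y
          using that A(2)[of x y] A(2)[of y x] by (cases "x < y") (auto simp: C_def Bn)
        then show "real (card ?G) \<le> real (Suc (card C) * 2 ^ (card B - card C))"
          unfolding E_def of_nat_le_iff
          by (intro card_triangle_free_extensions_le finB CB) auto
      qed
      also have "\<dots> = 2 ^ card B * (chain_ratio (card C) * p)"
      proof -
        have "(2::real) ^ card B = 2 ^ (card B - card C) * 2 ^ card C"
          using card_mono[OF finB CB] by (simp flip: power_add)
        then show ?thesis by (simp add: chain_ratio_def field_simps)
      qed
      finally show ?thesis by (simp add: hn tf)
    qed
  qed
  \<comment> \<open>Some choice does not exceed the average.\<close>
  have "\<exists>Y\<in>Pow B. (\<Sum>S\<in>\<F>. h (Suc n) (E Y) S) \<le> (\<Sum>S\<in>\<F>. h n A S)"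
  proof (rule ccontr)
    assume "\<not> ?thesis"
    then have "(\<Sum>Y\<in>Pow B. \<Sum>S\<in>\<F>. h n A S) < (\<Sum>Y\<in>Pow B. \<Sum>S\<in>\<F>. h (Suc n) (E Y) S)"
      using finB by (intro sum_strict_mono[of "Pow B"]) (auto simp: not_le)
    also have "\<dots> = (\<Sum>S\<in>\<F>. \<Sum>Y\<in>Pow B. h (Suc n) (E Y) S)"
      by (rule sum.swap)
    also have "\<dots> \<le> (\<Sum>S\<in>\<F>. 2 ^ card B * h n A S)"
      by (intro sum_mono avg)
    finally show False by (simp add: card_Pow finB sum_distrib_left)
  qed
  then obtain Y where Y: "Y \<subseteq> B" "(\<Sum>S\<in>\<F>. h (Suc n) (E Y) S) \<le> (\<Sum>S\<in>\<F>. h n A S)"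
    by blast
  have "path_power_orientation N (Suc n) (E Y)"
    using A(1) Y(1) Bn unfolding path_power_orientation_def E_def by fastforce
  moreover have "(u, v) \<in> E Y \<or> (v, u) \<in> E Y" if "u < v" "v < Suc n" "v < u + N" for u v
    using that A(2)[of u v] by (cases "v = n") (auto simp: E_def Bn)
  ultimately show ?case
    using order_trans[OF Y(2) A(3)] unfolding h_def r_def by blast
qed

section \<open>First-moment criterion and concatenation of segments\<close>

definition sparse_orientable :: "nat \<Rightarrow> nat \<Rightarrow> nat \<Rightarrow> bool" where
  "sparse_orientable N n t \<longleftrightarrow> (\<exists>A. path_power_orientation N n A \<and>
     (\<forall>S. S \<subseteq> {..<n} \<and> triangle_free A S \<longrightarrow> card S \<le> t))"

text \<open>The sum bounds the expected number of triangle-free sets of size \<open>t + 1\<close>,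
  so some orientation has none; a larger triangle-free set would contain one of that size.\<close>

lemma sparse_orientable_first_moment:
  assumes "(\<Sum>S | S \<subseteq> {..<n} \<and> card S = Suc t.
              \<Prod>v\<in>S. chain_ratio (card (nbrs_before N v \<inter> S))) < 1"
  shows "sparse_orientable N n t"
proof -
  let ?F = "{S. S \<subseteq> {..<n} \<and> card S = Suc t}"
  have finF: "finite ?F" by (rule finite_subset[of _ "Pow {..<n}"]) auto
  obtain A where A: "path_power_orientation N n A"
      "(\<Sum>S\<in>?F. if triangle_free A (S \<inter> {..<n})
                   then \<Prod>v\<in>S - {..<n}. chain_ratio (card (nbrs_before N v \<inter> S)) else 0) < 1"
    using exists_orientation_few_triangle_free[OF finF, of N n] assms
    by (force intro: finite_subset[of _ "{..<n}"])
  \<comment> \<open>With every vertex processed the products are empty, and the potential counts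
    triangle-free sets.\<close>
  have "(\<Sum>S\<in>?F. if triangle_free A (S \<inter> {..<n})
                   then \<Prod>v\<in>S - {..<n}. chain_ratio (card (nbrs_before N v \<inter> S)) else 0)
      = (\<Sum>S\<in>?F. if triangle_free A S then 1 else 0)"
    by (intro sum.cong) (auto simp: Int_absorb2 Diff_eq_empty_iff[THEN iffD2])
  then have lt: "(\<Sum>S\<in>?F. if triangle_free A S then 1 else 0) < (1::real)"
    using A(2) by simp
  have no: "\<not> triangle_free A S" if "S \<in> ?F" for S
  proof
    assume "triangle_free A S"
    then have "1 \<le> (\<Sum>S\<in>?F. if triangle_free A S then 1 else (0::real))"
      using member_le_sum[of S ?F "\<lambda>S. if triangle_free A S then 1 else (0::real)"] that finF by simp
    with lt show False by simp
  qed
  have "card S \<le> t" if "S \<subseteq> {..<n}" "triangle_free A S" for S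
  proof (rule ccontr)
    assume "\<not> card S \<le> t"
    then obtain T where "T \<subseteq> S" "card T = Suc t"
      by (metis not_less_eq_eq obtain_subset_with_card_n)
    with that no[of T] triangle_free_mono[of A S A T] show False by auto
  qed
  with A(1) show ?thesis unfolding sparse_orientable_def by blast
qed

text \<open>The second orientation is shifted behind the first, with no arcs in between. A
  triangle-free set restricts to a triangle-free set on each segment.\<close>

lemma sparse_orientable_add:
  assumes "sparse_orientable N n t" "sparse_orientable N n' t'"
  shows "sparse_orientable N (n + n') (t + t')"
proof -
  obtain A where A: "path_power_orientation N n A"
      "\<And>S. S \<subseteq> {..<n} \<Longrightarrow> triangle_free A S \<Longrightarrow> card S \<le> t"
    using assms(1) unfolding sparse_orientable_def by blast
  obtain B where B: "path_power_orientation N n' B"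
      "\<And>S. S \<subseteq> {..<n'} \<Longrightarrow> triangle_free B S \<Longrightarrow> card S \<le> t'"
    using assms(2) unfolding sparse_orientable_def by blast
  define E where "E = A \<union> map_prod ((+) n) ((+) n) ` B"
  have "path_power_orientation N (n + n') E"
    using A(1) B(1) unfolding path_power_orientation_def E_def by fastforce
  moreover have "card S \<le> t + t'" if S: "S \<subseteq> {..<n + n'}" "triangle_free E S" for S
  proof -
    define T where "T = {i. n + i \<in> S}"
    have T: "T \<subseteq> {..<n'}" using S(1) by (auto simp: T_def)
    have "triangle_free B T"
      using S(2) unfolding triangle_free_def E_def T_def
      by (force simp: map_prod_def image_iff)
    with T have cT: "card T \<le> t'" by (rule B(2))
    have "triangle_free A (S \<inter> {..<n})"
      by (rule triangle_free_mono[OF S(2)]) (auto simp: E_def)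
    then have cS: "card (S \<inter> {..<n}) \<le> t" by (intro A(2)) auto
    have "x \<in> S \<inter> {..<n} \<union> (+) n ` T" if "x \<in> S" for x
      using that by (cases "x < n") (auto simp: T_def image_iff intro!: exI[of _ "x - n"])
    then have "S \<subseteq> S \<inter> {..<n} \<union> (+) n ` T" by blast
    then have "card S \<le> card (S \<inter> {..<n} \<union> (+) n ` T)"
      using T by (intro card_mono) (auto intro: finite_subset)
    also have "\<dots> \<le> card (S \<inter> {..<n}) + card ((+) n ` T)" by (rule card_Un_le)
    also have "card ((+) n ` T) = card T" by (simp add: card_image)
    finally show ?thesis using cS cT by simp
  qed
  ultimately show ?thesis unfolding sparse_orientable_def by blast
qed

lemma sparse_orientable_trivial: "sparse_orientable N n n"
  unfolding sparse_orientable_def path_power_orientation_def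
  by (rule exI[of _ "{}"]) (use card_mono[of "{..<n}"] in auto)

lemma sparse_orientable_mult:
  assumes "sparse_orientable N n t"
  shows "sparse_orientable N (i * n) (i * t)"
proof (induction i)
  case 0
  show ?case using sparse_orientable_trivial[of N 0] by simp
next
  case (Suc i)
  show ?case using sparse_orientable_add[OF assms Suc] by simp
qed

section \<open>First moments of one clique\<close>

text \<open>Probability that a random tournament on \<open>a\<close> vertices is transitive, in the
  product form that the vertex-by-vertex bound yields.\<close>

definition chain_weight :: "nat \<Rightarrow> real" where
  "chain_weight a = (\<Prod>i<a. chain_ratio i)"

lemma chain_weight_pos: "chain_weight a > 0"
  by (simp add: chain_weight_def chain_ratio_pos prod_pos)

lemma chain_weight_Suc: "chain_weight (Suc a) = chain_weight a * chain_ratio a"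
  by (simp add: chain_weight_def)

lemma chain_weight_eq: "chain_weight a = fact a / 2 ^ (a choose 2)"
proof (induction a)
  case (Suc a)
  have "Suc a choose 2 = a + (a choose 2)" by (simp add: numeral_2_eq_2)
  with Suc show ?case
    by (simp add: chain_weight_Suc chain_ratio_def power_add field_simps)
qed (simp add: chain_weight_def numeral_2_eq_2)

text \<open>The rank of \<open>v\<close> in \<open>S\<close> takes every value below
  \<open>card S\<close> exactly once.\<close>

lemma prod_card_below:
  fixes h :: "nat \<Rightarrow> real" and S :: "nat set"
  assumes "finite S"
  shows "(\<Prod>v\<in>S. h (card {u \<in> S. u < v})) = (\<Prod>i<card S. h i)"
  using assms
proof (induction S rule: finite_linorder_max_induct)
  case (insert b S)
  have "{u \<in> insert b S. u < b} = S" using insert by auto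
  moreover have "{u \<in> insert b S. u < v} = {u \<in> S. u < v}" if "v \<in> S" for v
    using insert that by force
  moreover have "b \<notin> S" using insert by auto
  ultimately show ?case using insert by simp
qed simp

lemma prod_chain_ratio_clique:
  assumes "finite S"
  shows "(\<Prod>v\<in>S \<inter> {..<N}. chain_ratio (card (nbrs_before N v \<inter> S))) = chain_weight (card (S \<inter> {..<N}))"
proof -
  have "nbrs_before N v \<inter> S = {u \<in> S \<inter> {..<N}. u < v}" if "v \<in> S \<inter> {..<N}" for v
    using that by (auto simp: nbrs_before_def)
  then show ?thesis
    using prod_card_below[of "S \<inter> {..<N}" chain_ratio] assms
    by (simp add: chain_weight_def)
qed

lemma sum_chain_ratio_clique:
  "(\<Sum>S | S \<subseteq> {..<N} \<and> card S = s. \<Prod>v\<in>S. chain_ratio (card (nbrs_before N v \<inter> S)))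
     = real (N choose s) * chain_weight s"
proof -
  have "(\<Sum>S | S \<subseteq> {..<N} \<and> card S = s. \<Prod>v\<in>S. chain_ratio (card (nbrs_before N v \<inter> S)))
      = (\<Sum>S | S \<subseteq> {..<N} \<and> card S = s. chain_weight s)"
  proof (rule sum.cong)
    fix S assume "S \<in> {S. S \<subseteq> {..<N} \<and> card S = s}"
    then show "(\<Prod>v\<in>S. chain_ratio (card (nbrs_before N v \<inter> S))) = chain_weight s"
      using prod_chain_ratio_clique[of S N] finite_subset[of S "{..<N}"] by (simp add: Int_absorb2)
  qed simp
  then show ?thesis by (simp add: n_subsets)
qed

lemma chain_ratio_Suc_le: "chain_ratio (Suc d) \<le> chain_ratio d"
  by (simp add: chain_ratio_def field_simps)

lemma chain_ratio_antimono: "i \<le> j \<Longrightarrow> chain_ratio j \<le> chain_ratio i"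
  by (rule lift_Suc_antimono_le[of chain_ratio]) (simp_all add: chain_ratio_Suc_le)

text \<open>Vertex \<open>N\<close> is adjacent to every earlier vertex except \<open>0\<close>. In
  a set containing it, it has at least \<open>q\<close> neighbours among the other
  \<open>q + 1\<close> vertices; this gives the second term.\<close>

lemma sum_chain_ratio_clique_Suc_le:
  "(\<Sum>S | S \<subseteq> {..<Suc N} \<and> card S = Suc (Suc q). \<Prod>v\<in>S. chain_ratio (card (nbrs_before N v \<inter> S)))
     \<le> real (N choose Suc (Suc q)) * chain_weight (Suc (Suc q))
        + real (N choose Suc q) * (chain_weight (Suc q) * chain_ratio q)"
proof -
  define w where "w S = (\<Prod>v\<in>S. chain_ratio (card (nbrs_before N v \<inter> S)))" for S
  define X where "X k = {S. S \<subseteq> {..<N} \<and> card S = k}" for k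
  have finX: "finite (X k)" for k
    by (rule finite_subset[of _ "Pow {..<N}"]) (auto simp: X_def)
  have notin: "N \<notin> T" "finite T" if "T \<in> X k" for T k
    using that finite_subset[of T "{..<N}"] by (auto simp: X_def)
  have split: "{S. S \<subseteq> {..<Suc N} \<and> card S = Suc (Suc q)} = X (Suc (Suc q)) \<union> insert N ` X (Suc q)"
  proof (intro equalityI subsetI)
    fix S assume S: "S \<in> {S. S \<subseteq> {..<Suc N} \<and> card S = Suc (Suc q)}"
    show "S \<in> X (Suc (Suc q)) \<union> insert N ` X (Suc q)"
    proof (cases "N \<in> S")
      case True
      then have "S = insert N (S - {N})" by blast
      moreover have "S - {N} \<in> X (Suc q)"
        using S True finite_subset[of S "{..<Suc N}"] by (auto simp: X_def less_Suc_eq)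
      ultimately show ?thesis by blast
    next
      case False
      with S show ?thesis by (auto simp: X_def less_Suc_eq)
    qed
  next
    fix S assume "S \<in> X (Suc (Suc q)) \<union> insert N ` X (Suc q)"
    then consider "S \<in> X (Suc (Suc q))" | T where "T \<in> X (Suc q)" "S = insert N T" by blast
    then show "S \<in> {S. S \<subseteq> {..<Suc N} \<and> card S = Suc (Suc q)}"
    proof cases
      case 1
      then show ?thesis by (auto simp: X_def less_Suc_eq)
    next
      case (2 T)
      with notin[OF 2(1)] show ?thesis by (auto simp: X_def less_Suc_eq)
    qed
  qed
  have ins: "w (insert N T) \<le> chain_weight (Suc q) * chain_ratio q" if T: "T \<in> X (Suc q)" for T
  proof -
    note nT = notin[OF T]
    have TN: "T \<subseteq> {..<N}" "card T = Suc q" using T by (auto simp: X_def)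
    have "insert N T \<inter> {..<N} = T" using TN by auto
    then have "(\<Prod>v\<in>T. chain_ratio (card (nbrs_before N v \<inter> insert N T))) = chain_weight (Suc q)"
      using prod_chain_ratio_clique[of "insert N T" N] nT TN by simp
    moreover have "T - {0} \<subseteq> nbrs_before N N \<inter> insert N T"
      using TN by (auto simp: nbrs_before_def)
    then have "card (T - {0}) \<le> card (nbrs_before N N \<inter> insert N T)"
      by (intro card_mono) auto
    then have "q \<le> card (nbrs_before N N \<inter> insert N T)"
      using TN by (cases "0 \<in> T") (auto simp: card_Diff_singleton_if)
    then have "chain_ratio (card (nbrs_before N N \<inter> insert N T)) \<le> chain_ratio q"
      by (rule chain_ratio_antimono)
    ultimately show ?thesis
      using nT chain_weight_pos[of "Suc q"] by (simp add: w_def mult.commute[of "chain_ratio _"])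
  qed
  have "inj_on (insert N) (X (Suc q))"
    by (rule inj_onI) (metis notin(1) insert_ident)
  moreover have "X (Suc (Suc q)) \<inter> insert N ` X (Suc q) = {}"
    using notin(1) by blast
  ultimately have "(\<Sum>S | S \<subseteq> {..<Suc N} \<and> card S = Suc (Suc q). w S)
      = (\<Sum>S\<in>X (Suc (Suc q)). w S) + (\<Sum>T\<in>X (Suc q). w (insert N T))"
    unfolding split using finX by (simp add: sum.union_disjoint sum.reindex)
  also have "(\<Sum>T\<in>X (Suc q). w (insert N T)) \<le> (\<Sum>T\<in>X (Suc q). chain_weight (Suc q) * chain_ratio q)"
    by (intro sum_mono ins)
  also have "\<dots> = real (N choose Suc q) * (chain_weight (Suc q) * chain_ratio q)"
    by (simp add: X_def n_subsets)
  also have "(\<Sum>S\<in>X (Suc (Suc q)). w S) = real (N choose Suc (Suc q)) * chain_weight (Suc (Suc q))"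
    unfolding X_def w_def by (rule sum_chain_ratio_clique)
  finally show ?thesis unfolding w_def by simp
qed

section \<open>Two consecutive cliques\<close>

text \<open>The vertices \<open>x\<close> and \<open>N + x\<close> form level \<open>x\<close>. In the sums below \<open>j\<close> counts the vertices of the
  second half already chosen on lower levels.\<close>

definition levels_from :: "nat \<Rightarrow> nat \<Rightarrow> nat set" where
  "levels_from N x = {x..<N} \<union> {N + x..<2 * N}"

text \<open>First-half factors are left out; they multiply to \<open>chain_weight a\<close> and
  return in \<open>sum_chain_ratio_double_clique\<close>.\<close>

definition split_weight :: "nat \<Rightarrow> nat \<Rightarrow> nat \<Rightarrow> nat \<Rightarrow> nat set \<Rightarrow> real" where
  "split_weight N j a b S =
     (if card (S \<inter> {..<N}) = a \<and> card (S - {..<N}) = b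
      then \<Prod>v\<in>S - {..<N}. chain_ratio (j + card (nbrs_before N v \<inter> S)) else 0)"

definition level_sum :: "nat \<Rightarrow> nat \<Rightarrow> nat \<Rightarrow> nat \<Rightarrow> nat \<Rightarrow> real" where
  "level_sum N x j a b = (\<Sum>S\<in>Pow (levels_from N x). split_weight N j a b S)"

lemma sum_Pow_insert:
  assumes "finite U" "z \<notin> U"
  shows "(\<Sum>S\<in>Pow (insert z U). f S) = (\<Sum>S\<in>Pow U. f S) + (\<Sum>S\<in>Pow U. f (insert z S))"
proof -
  have "inj_on (insert z) (Pow U)"
    using assms(2) by (intro inj_onI) (metis PowD insert_ident subsetD)
  moreover have "Pow U \<inter> insert z ` Pow U = {}" using assms(2) by auto
  ultimately show ?thesis
    using assms(1) by (simp add: Pow_insert sum.union_disjoint sum.reindex)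
qed

text \<open>Every second-half vertex of \<open>T\<close> is at distance at least \<open>N\<close>
  from \<open>x\<close>, so \<open>x\<close> changes no factor.\<close>

lemma split_weight_insert_low:
  assumes "x < N" "T \<subseteq> {Suc x..<N} \<union> {N + x..<2 * N}"
  shows "split_weight N j a b (insert x T) = (case a of 0 \<Rightarrow> 0 | Suc a' \<Rightarrow> split_weight N j a' b T)"
proof -
  have fin: "finite T" using assms(2) finite_subset by blast
  have "insert x T \<inter> {..<N} = insert x (T \<inter> {..<N})" "insert x T - {..<N} = T - {..<N}"
    "x \<notin> T \<inter> {..<N}"
    using assms by auto
  moreover have "nbrs_before N v \<inter> insert x T = nbrs_before N v \<inter> T" if "v \<in> T - {..<N}" for v
    using that assms by (force simp: nbrs_before_def)
  ultimately show ?thesis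
    using fin by (auto simp: split_weight_def split: nat.split)
qed

text \<open>All \<open>a\<close> first-half vertices of \<open>T\<close> lie on higher levels and
  are adjacent to \<open>N + x\<close>, whence its factor. In turn \<open>N + x\<close> is an
  earlier neighbour of all second-half vertices of \<open>T\<close>, which raises
  \<open>j\<close>.\<close>

lemma split_weight_insert_high:
  assumes "x < N" "T \<subseteq> levels_from N (Suc x)"
  shows "split_weight N j a b (insert (N + x) T)
           = (case b of 0 \<Rightarrow> 0 | Suc b' \<Rightarrow> chain_ratio (j + a) * split_weight N (Suc j) a b' T)"
proof -
  have fin: "finite T" using assms(2) finite_subset[of T] by (auto simp: levels_from_def)
  have eqs: "insert (N + x) T \<inter> {..<N} = T \<inter> {..<N}"
    "insert (N + x) T - {..<N} = insert (N + x) (T - {..<N})" "N + x \<notin> T"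
    using assms by (auto simp: levels_from_def)
  have "nbrs_before N v \<inter> insert (N + x) T = insert (N + x) (nbrs_before N v \<inter> T)"
    if "v \<in> T - {..<N}" for v
    using that assms by (force simp: nbrs_before_def levels_from_def)
  then have "card (nbrs_before N v \<inter> insert (N + x) T) = Suc (card (nbrs_before N v \<inter> T))"
    if "v \<in> T - {..<N}" for v
    using that fin eqs(3) by simp
  moreover have "nbrs_before N (N + x) \<inter> insert (N + x) T = T \<inter> {..<N}"
    using assms by (force simp: nbrs_before_def levels_from_def)
  ultimately show ?thesis
    using fin eqs by (auto simp: split_weight_def split: nat.split)
qed

text \<open>Four cases: level \<open>x\<close> contributes nothing, \<open>x\<close>,
  \<open>N + x\<close>, or both. In the last case the factor involves \<open>a'\<close> because
  \<open>x\<close> and \<open>N + x\<close> are not adjacent.\<close>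

lemma level_sum_step:
  assumes "x < N"
  shows "level_sum N x j a b = level_sum N (Suc x) j a b
      + (case a of 0 \<Rightarrow> 0 | Suc a' \<Rightarrow> level_sum N (Suc x) j a' b)
      + (case b of 0 \<Rightarrow> 0 | Suc b' \<Rightarrow> chain_ratio (j + a) * level_sum N (Suc x) (Suc j) a b')
      + (case a of 0 \<Rightarrow> 0 | Suc a' \<Rightarrow> (case b of 0 \<Rightarrow> 0 | Suc b' \<Rightarrow>
           chain_ratio (j + a') * level_sum N (Suc x) (Suc j) a' b'))"
proof -
  let ?U = "levels_from N (Suc x)"
  have U: "levels_from N x = insert x (insert (N + x) ?U)" "finite ?U"
    "x \<notin> insert (N + x) ?U" "N + x \<notin> ?U"
    using assms by (auto simp: levels_from_def)
  have low: "split_weight N j a b (insert x T) = (case a of 0 \<Rightarrow> 0 | Suc a' \<Rightarrow> split_weight N j a' b T)"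
    if "T \<in> Pow (insert (N + x) ?U)" for T
    by (rule split_weight_insert_low[OF assms]) (use that assms in \<open>auto simp: levels_from_def\<close>)
  have high: "split_weight N j a b (insert (N + x) T)
      = (case b of 0 \<Rightarrow> 0 | Suc b' \<Rightarrow> chain_ratio (j + a) * split_weight N (Suc j) a b' T)"
    if "T \<in> Pow ?U" for T a
    by (rule split_weight_insert_high[OF assms]) (use that in auto)
  have dn: "(\<Sum>S\<in>Pow (insert (N + x) ?U). split_weight N j a b S) = level_sum N (Suc x) j a b
        + (case b of 0 \<Rightarrow> 0 | Suc b' \<Rightarrow> chain_ratio (j + a) * level_sum N (Suc x) (Suc j) a b')" for a
  proof -
    have "(\<Sum>S\<in>Pow (insert (N + x) ?U). split_weight N j a b S)
        = level_sum N (Suc x) j a b + (\<Sum>S\<in>Pow ?U. split_weight N j a b (insert (N + x) S))"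
      unfolding level_sum_def by (rule sum_Pow_insert) (use U in auto)
    also have "(\<Sum>S\<in>Pow ?U. split_weight N j a b (insert (N + x) S))
        = (\<Sum>S\<in>Pow ?U. case b of 0 \<Rightarrow> 0 | Suc b' \<Rightarrow> chain_ratio (j + a) * split_weight N (Suc j) a b' S)"
      by (intro sum.cong refl high)
    finally show ?thesis
      by (simp add: level_sum_def sum_distrib_left split: nat.split)
  qed
  have "level_sum N x j a b
      = (\<Sum>S\<in>Pow (insert (N + x) ?U). split_weight N j a b S)
        + (\<Sum>S\<in>Pow (insert (N + x) ?U). case a of 0 \<Rightarrow> 0 | Suc a' \<Rightarrow> split_weight N j a' b S)"
  proof -
    have "level_sum N x j a b
        = (\<Sum>S\<in>Pow (insert (N + x) ?U). split_weight N j a b S)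
          + (\<Sum>S\<in>Pow (insert (N + x) ?U). split_weight N j a b (insert x S))"
      unfolding level_sum_def U(1) by (rule sum_Pow_insert) (use U in auto)
    also have "(\<Sum>S\<in>Pow (insert (N + x) ?U). split_weight N j a b (insert x S))
        = (\<Sum>S\<in>Pow (insert (N + x) ?U). case a of 0 \<Rightarrow> 0 | Suc a' \<Rightarrow> split_weight N j a' b S)"
      by (intro sum.cong refl low)
    finally show ?thesis .
  qed
  then show ?thesis
    by (cases a) (auto simp: dn split: nat.split)
qed

section \<open>Words recording the interleaving, and their supersolutions\<close>

text \<open>\<open>word_sum\<close> runs over all words with \<open>a\<close> letters for the first half and \<open>b\<close> for the second, read
  by increasing level, and weights them by \<open>f\<close> of the number of places where a second-half letter
  follows a first-half letter. Such a pair may share a level, so a word with \<open>t\<close> of these places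
  arises from \<open>(N + t) choose (a + b)\<close> sets. The flag tells whether the last letter was from the first
  half.\<close>

fun word_sum :: "bool \<Rightarrow> (nat \<Rightarrow> real) \<Rightarrow> nat \<Rightarrow> nat \<Rightarrow> nat \<Rightarrow> real" where
  "word_sum l f j 0 0 = f 0"
| "word_sum l f j (Suc a) 0 = word_sum True f j a 0"
| "word_sum l f j 0 (Suc b) =
     chain_ratio j * word_sum False (if l then \<lambda>t. f (Suc t) else f) (Suc j) 0 b"
| "word_sum l f j (Suc a) (Suc b) = word_sum True f j a (Suc b)
     + chain_ratio (j + Suc a) * word_sum False (if l then \<lambda>t. f (Suc t) else f) (Suc j) (Suc a) b"

lemma word_sum_0 [simp]: "word_sum l f j a 0 = f 0"
  by (induction a arbitrary: l) auto

lemma word_sum_add: "word_sum l (\<lambda>t. f t + h t) j a b = word_sum l f j a b + word_sum l h j a b"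
  by (induction l f j a b arbitrary: h rule: word_sum.induct)
    (auto simp: distrib_left)

lemma word_sum_cmult: "word_sum l (\<lambda>t. c * f t) j a b = c * word_sum l f j a b"
  by (induction l f j a b rule: word_sum.induct) (auto simp: algebra_simps)

lemma word_sum_mono: "(\<And>t. f t \<le> h t) \<Longrightarrow> word_sum l f j a b \<le> word_sum l h j a b"
proof (induction l f j a b arbitrary: h rule: word_sum.induct)
  case (3 l f j b)
  then show ?case by (cases l) (auto intro!: mult_left_mono chain_ratio_pos[THEN less_imp_le])
next
  case (4 l f j a b)
  then show ?case by (cases l) (auto intro!: add_mono mult_left_mono chain_ratio_pos[THEN less_imp_le])
qed auto

lemma word_sum_nonneg: "(\<And>t. 0 \<le> f t) \<Longrightarrow> 0 \<le> word_sum l f j a b"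
  using word_sum_mono[of "\<lambda>t. 0 * f t" f] by (simp only: word_sum_cmult) auto

text \<open>The flag only affects words whose next letter is from the second half; these gain one
  counted place.\<close>

lemma word_sum_True_Suc:
  "word_sum True f j a (Suc b) = word_sum False f j a (Suc b)
     + chain_ratio (j + a) * (word_sum False (\<lambda>t. f (Suc t)) (Suc j) a b - word_sum False f (Suc j) a b)"
  by (cases a) (auto simp: algebra_simps)

text \<open>Induction on the number \<open>n\<close> of remaining levels. Pascal's rule separates an
  empty lowest level from a used one, and the result matches the four terms of
  \<open>level_sum_step\<close>.\<close>

lemma level_sum_le_word_sum:
  "n \<le> N \<Longrightarrow> level_sum N (N - n) j a b \<le> word_sum False (\<lambda>t. real ((n + t) choose (a + b))) j a b"
proof (induction n arbitrary: j a b)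
  case 0
  have "level_sum N N j a b = (if a = 0 \<and> b = 0 then 1 else 0)"
    by (auto simp: level_sum_def levels_from_def split_weight_def)
  moreover have "0 \<le> word_sum False (\<lambda>t. real ((0 + t) choose (a + b))) j a b"
    by (rule word_sum_nonneg) simp
  ultimately show ?case by auto
next
  case (Suc n)
  define f where "f r t = real ((n + t) choose r)" for r t
  have IH: "level_sum N (N - n) j a b \<le> word_sum False (f (a + b)) j a b" for j a b
    using Suc by (simp add: f_def[abs_def])
  have IHm: "chain_ratio i * level_sum N (N - n) j a b \<le> chain_ratio i * word_sum False (f (a + b)) j a b"
    for i j a b
    by (intro mult_left_mono IH less_imp_le chain_ratio_pos)
  have N: "N - Suc n < N" "Suc (N - Suc n) = N - n" using Suc.prems by auto
  have f_split: "(\<lambda>t. real ((Suc n + t) choose Suc r)) = (\<lambda>t. f (Suc r) t + f r t)" for r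
    by (auto simp: f_def)
  \<comment> \<open>Pascal's rule for one more counted place; the surplus \<open>f r\<close> becomes
    the term where both vertices share the level.\<close>
  have f_shift: "(\<lambda>t. f (Suc r) (Suc t)) = (\<lambda>t. f (Suc r) t + f r t)" for r
    by (auto simp: f_def)
  note step = level_sum_step[OF N(1), of j a b, unfolded N(2)]
  show ?case
  proof (cases a)
    case a: 0
    show ?thesis
    proof (cases b)
      case 0
      then show ?thesis using IH[of j 0 0] a step by (simp add: f_def)
    next
      case (Suc b')
      have "word_sum False (\<lambda>t. real ((Suc n + t) choose (a + b))) j a b
          = word_sum False (f b) j 0 b + chain_ratio j * word_sum False (f b') (Suc j) 0 b'"
        using Suc f_split[of b'] by (simp add: a word_sum_add algebra_simps)
      then show ?thesis using step IH[of j 0 b] IHm[of j "Suc j" 0 b'] a Suc by simp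
    qed
  next
    case a: (Suc a')
    show ?thesis
    proof (cases b)
      case 0
      then show ?thesis using step a IH[of j a 0] IH[of j a' 0] f_split[of a'] by (simp add: f_def)
    next
      case b: (Suc b')
      have "word_sum False (\<lambda>t. real ((Suc n + t) choose (a + b))) j a b
          = word_sum False (f (a + b)) j a b + word_sum False (f (Suc (a' + b'))) j a b"
        using f_split[of "Suc (a' + b')"] a b by (simp only: word_sum_add add_Suc add_Suc_right)
      also have "word_sum False (f (Suc (a' + b'))) j a b
          = word_sum False (f (a' + b)) j a' b + chain_ratio (j + a') * word_sum False (f (a' + b')) (Suc j) a' b'
            + chain_ratio (j + a) * word_sum False (f (a + b')) (Suc j) a b'"
        by (simp add: a b word_sum_True_Suc f_shift word_sum_add)
      finally show ?thesis
        using step IH[of j a b] IH[of j a' b] IHm[of "j + a" "Suc j" a b'] IHm[of "j + a'" "Suc j" a' b']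
        by (simp add: a b)
    qed
  qed
qed

text \<open>The product is the weight of the second-half letters alone, and \<open>H\<close> bounds
  the remaining factor uniformly in \<open>b\<close>. In \<open>super\<close> the next letter is
  either from the first half, where an immediate second-half successor costs an extra
  \<open>\<delta>\<close>, or from the second half, which raises \<open>j\<close>.\<close>

lemma word_sum_power_le:
  fixes H :: "nat \<Rightarrow> nat \<Rightarrow> real" and \<delta> :: real
  defines "w \<equiv> \<lambda>a j. chain_ratio (j + a) / chain_ratio j"
  assumes "\<delta> \<ge> 0" and H1: "\<And>a j. 1 \<le> H a j" and H0: "\<And>j. H 0 (Suc j) \<le> H 0 j"
    and super: "\<And>a j. H a j + \<delta> * (w a j * H a (Suc j)) + w (Suc a) j * H (Suc a) (Suc j) \<le> H (Suc a) j"
  shows "word_sum False (\<lambda>t. (1 + \<delta>) ^ t) j a b \<le> (\<Prod>i<b. chain_ratio (j + i)) * H a j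
       \<and> word_sum True (\<lambda>t. (1 + \<delta>) ^ t) j a b
           \<le> (\<Prod>i<b. chain_ratio (j + i)) * (H a j + \<delta> * (w a j * H a (Suc j)))"
proof (induction b arbitrary: j a)
  case 0
  have "0 \<le> w a j * H a (Suc j)"
    using H1[of a "Suc j"] by (simp add: w_def chain_ratio_pos less_imp_le)
  then show ?case using H1[of a j] \<open>\<delta> \<ge> 0\<close> by (simp add: add_increasing2)
next
  case (Suc b)
  let ?f = "\<lambda>t. (1 + \<delta>) ^ t"
  define p where "p = (\<Prod>i<b. chain_ratio (Suc j + i))"
  have p: "p > 0" by (simp add: p_def chain_ratio_pos prod_pos)
  have P: "(\<Prod>i<Suc b. chain_ratio (j + i)) = chain_ratio j * p"
    by (simp add: p_def prod.lessThan_Suc_shift del: prod.lessThan_Suc)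
  have shift: "word_sum False (\<lambda>t. ?f (Suc t)) j a b = (1 + \<delta>) * word_sum False ?f j a b" for j a b
    using word_sum_cmult[of False "1 + \<delta>" ?f] by simp
  have IH: "chain_ratio (j + a) * word_sum False ?f (Suc j) a b
      \<le> chain_ratio j * p * (w a j * H a (Suc j))" for a
  proof -
    have "chain_ratio (j + a) * word_sum False ?f (Suc j) a b \<le> chain_ratio (j + a) * (p * H a (Suc j))"
      using Suc.IH[of "Suc j" a] by (simp add: p_def chain_ratio_pos)
    also have "\<dots> = chain_ratio j * p * (w a j * H a (Suc j))"
      using chain_ratio_pos[of j] by (simp add: w_def)
    finally show ?thesis .
  qed
  have IH\<delta>: "\<delta> * (chain_ratio (j + a) * word_sum False ?f (Suc j) a b)
      \<le> \<delta> * (chain_ratio j * p * (w a j * H a (Suc j)))" for a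
    by (intro mult_left_mono IH \<open>\<delta> \<ge> 0\<close>)
  have pj: "chain_ratio j * p > 0" using p chain_ratio_pos[of j] by simp
  \<comment> \<open>Raising the flag multiplies the words starting with a second-half letter by
    \<open>1 + \<delta>\<close>.\<close>
  have tr: "word_sum True ?f j a (Suc b) = word_sum False ?f j a (Suc b)
      + \<delta> * (chain_ratio (j + a) * word_sum False ?f (Suc j) a b)" for a
    unfolding word_sum_True_Suc shift by (simp add: algebra_simps)
  \<comment> \<open>Inner induction on \<open>a\<close>: reading a first-half letter leaves
    \<open>b\<close> unchanged.\<close>
  have *: "word_sum False ?f j a (Suc b) \<le> chain_ratio j * p * H a j" for a
  proof (induction a)
    case 0
    have "w 0 j = 1" using chain_ratio_pos[of j] by (simp add: w_def)
    then have "word_sum False ?f j 0 (Suc b) \<le> chain_ratio j * p * H 0 (Suc j)"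
      using IH[of 0] by simp
    also have "\<dots> \<le> chain_ratio j * p * H 0 j"
      using H0[of j] pj by (intro mult_left_mono) auto
    finally show ?case .
  next
    case (Suc a)
    have "word_sum False ?f j (Suc a) (Suc b)
        \<le> chain_ratio j * p * (H a j + \<delta> * (w a j * H a (Suc j)) + w (Suc a) j * H (Suc a) (Suc j))"
      using Suc tr[of a] IH\<delta>[of a] IH[of "Suc a"] by (simp add: algebra_simps)
    also have "\<dots> \<le> chain_ratio j * p * H (Suc a) j"
      using super[of a j] pj by (intro mult_left_mono) auto
    finally show ?case .
  qed
  show ?case unfolding P
    using *[of a] tr[of a] IH\<delta>[of a] by (simp add: algebra_simps)
qed

section \<open>An explicit supersolution and a bound on its limit\<close>

text \<open>The function \<open>env_const \<delta> c + env_slope \<delta> c / (j + 1)\<close> is a supersolution of the recursion for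
  \<open>word_sum\<close> with \<open>f t = (1 + \<delta>) ^ t\<close>, where \<open>c\<close> first-half letters are still to come. The two sequences
  come from comparing the coefficients of \<open>1\<close> and \<open>1 / (j + 1)\<close>.\<close>

primrec env_const :: "real \<Rightarrow> nat \<Rightarrow> real" where
  "env_const \<delta> 0 = 1"
| "env_const \<delta> (Suc c) = (1 + \<delta> / 2 ^ c) * env_const \<delta> c / (1 - 1 / 2 ^ Suc c)"

primrec env_slope :: "real \<Rightarrow> nat \<Rightarrow> real" where
  "env_slope \<delta> 0 = 0"
| "env_slope \<delta> (Suc c) =
     (env_slope \<delta> c + \<delta> * (real c * env_const \<delta> c + (real c + 1) / 2 * env_slope \<delta> c) / 2 ^ c
        + (real c + 1) * env_const \<delta> (Suc c) / 2 ^ Suc c) / (1 - (real c + 2) / 2 ^ (c + 2))"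

lemma env_slope_denominator: "1 - (real c + 2) / 2 ^ (c + 2) > 0"
proof -
  have "2 * (c + 2) \<le> 2 ^ (c + 2)" by (induction c) auto
  then have "2 * (real c + 2) \<le> 2 ^ (c + 2)"
    by (metis (mono_tags, lifting) of_nat_add of_nat_le_iff of_nat_mult of_nat_numeral of_nat_power)
  then show ?thesis by (simp add: field_simps)
qed

lemma env_const_denominator: "1 - 1 / (2::real) ^ Suc c > 0"
  using one_less_power[of "2::real" "Suc c"] by (simp add: field_simps)

lemma env_const_step:
  "env_const \<delta> (Suc c) * (1 - 1 / 2 ^ Suc c) = (1 + \<delta> / 2 ^ c) * env_const \<delta> c"
  using env_const_denominator[of c] by simp

lemma env_slope_step:
  "env_slope \<delta> (Suc c) * (1 - (real c + 2) / 2 ^ (c + 2))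
     = env_slope \<delta> c + \<delta> * (real c * env_const \<delta> c + (real c + 1) / 2 * env_slope \<delta> c) / 2 ^ c
        + (real c + 1) * env_const \<delta> (Suc c) / 2 ^ Suc c"
  using env_slope_denominator[of c] by (simp del: env_const.simps)

lemma env_const_ge_1:
  assumes "\<delta> \<ge> 0"
  shows "1 \<le> env_const \<delta> c"
proof (induction c)
  case (Suc c)
  have "env_const \<delta> (Suc c) * (1 - 1 / 2 ^ Suc c) \<ge> 1 * 1"
    unfolding env_const_step using Suc assms by (intro mult_mono) auto
  moreover have "env_const \<delta> (Suc c) * (1 - 1 / 2 ^ Suc c) \<le> env_const \<delta> (Suc c)"
    if "env_const \<delta> (Suc c) \<ge> 0"
    using that by (intro mult_left_le) auto
  moreover have "env_const \<delta> (Suc c) \<ge> 0"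
    using Suc assms env_const_denominator[of c] by simp
  ultimately show ?case by linarith
qed simp

lemma env_slope_nonneg:
  assumes "\<delta> \<ge> 0"
  shows "0 \<le> env_slope \<delta> c"
proof (induction c)
  case (Suc c)
  have "0 \<le> env_const \<delta> c" "0 \<le> env_const \<delta> (Suc c)"
    using env_const_ge_1[OF assms] order_trans zero_le_one by blast+
  then show ?case
    unfolding env_slope.simps(2)
    using Suc assms env_slope_denominator[of c]
    by (intro divide_nonneg_pos add_nonneg_nonneg mult_nonneg_nonneg divide_nonneg_nonneg) auto
qed simp

lemma env_mono:
  assumes "\<delta> \<ge> 0"
  shows "mono (env_const \<delta>)" "mono (env_slope \<delta>)"
proof -
  note A = env_const_ge_1[OF assms] and D = env_slope_nonneg[OF assms]
  have "env_const \<delta> c \<le> env_const \<delta> (Suc c)" for c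
  proof -
    have "env_const \<delta> c \<le> (1 + \<delta> / 2 ^ c) * env_const \<delta> c"
      using assms A[of c] by (simp add: algebra_simps)
    also have "\<dots> \<le> env_const \<delta> (Suc c) * 1"
      unfolding env_const_step[symmetric] using A[of "Suc c"] by (intro mult_left_mono) auto
    finally show ?thesis by simp
  qed
  then show "mono (env_const \<delta>)" by (simp add: mono_iff_le_Suc)
  have "env_slope \<delta> c \<le> env_slope \<delta> (Suc c)" for c
  proof -
    have "0 \<le> env_const \<delta> c" "0 \<le> env_const \<delta> (Suc c)"
      using A order_trans zero_le_one by blast+
    then have "env_slope \<delta> c \<le> env_slope \<delta> (Suc c) * (1 - (real c + 2) / 2 ^ (c + 2))"
      unfolding env_slope_step using assms D[of c]
      by (simp add: add_increasing2 del: env_const.simps)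
    also have "\<dots> \<le> env_slope \<delta> (Suc c) * 1"
      using D[of "Suc c"] by (intro mult_left_mono) auto
    finally show ?thesis by simp
  qed
  then show "mono (env_slope \<delta>)" by (simp add: mono_iff_le_Suc)
qed

text \<open>The quotient of chain ratios is \<open>(1 + c / (j + 1)) / 2 ^ c\<close>. Once the
  quadratic term in \<open>1 / (j + 1)\<close> is bounded by a linear one, the two coefficients
  satisfy the recursions of \<open>env_const\<close> and \<open>env_slope\<close> with
  equality.\<close>

lemma env_supersolution:
  fixes \<delta> :: real
  defines "H \<equiv> \<lambda>c j. env_const \<delta> c + env_slope \<delta> c / (real j + 1)"
  assumes "\<delta> \<ge> 0"
  shows "H c j + \<delta> * (chain_ratio (j + c) / chain_ratio j * H c (Suc j))
           + chain_ratio (j + Suc c) / chain_ratio j * H (Suc c) (Suc j) \<le> H (Suc c) j"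
proof -
  note A = env_const_ge_1[OF assms(2)] and D = env_slope_nonneg[OF assms(2)]
  define \<kappa> where "\<kappa> c = (real c * env_const \<delta> c + (real c + 1) / 2 * env_slope \<delta> c) / 2 ^ c" for c
  have bound: "chain_ratio (j + c) / chain_ratio j * H c (Suc j)
      \<le> env_const \<delta> c / 2 ^ c + \<kappa> c / (real j + 1)" for c
  proof -
    have alg: "u / x / z * (A + D / y) = (u / x * A + u / (x * y) * D) / z" for u x y z A D :: real
      by (simp add: add_divide_distrib distrib_left)
    have alg': "((1 + u / x) * A + v / x * D) / z = A / z + (u * A + v * D) / z / x" for u v x z A D :: real
      by (simp add: add_divide_distrib ring_distribs mult_ac)
    have Suc: "real (Suc j) + 1 = real j + 2" by simp
    have ratio: "chain_ratio (j + c) / chain_ratio j = (real j + 1 + real c) / (real j + 1) / 2 ^ c"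
      by (simp add: chain_ratio_def power_add add_ac)
    have "chain_ratio (j + c) / chain_ratio j * H c (Suc j)
        = ((real j + 1 + real c) / (real j + 1) * env_const \<delta> c
           + (real j + 1 + real c) / ((real j + 1) * (real j + 2)) * env_slope \<delta> c) / 2 ^ c"
      unfolding ratio H_def Suc by (rule alg)
    also have "\<dots> \<le> ((1 + real c / (real j + 1)) * env_const \<delta> c
           + (real c + 1) / 2 / (real j + 1) * env_slope \<delta> c) / 2 ^ c"
    proof (intro divide_right_mono add_mono)
      show "(real j + 1 + real c) / ((real j + 1) * (real j + 2)) * env_slope \<delta> c
          \<le> (real c + 1) / 2 / (real j + 1) * env_slope \<delta> c"
      \<comment> \<open>For positive \<open>c\<close>, \<open>(j + 1 + c) / (j + 2)\<close> is
        largest at \<open>j = 0\<close>; for \<open>c = 0\<close> the slope vanishes.\<close>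
      proof (cases c)
        case (Suc c')
        have "(real j + 1 + real c) / (real j + 2) \<le> (real c + 1) / 2"
          by (simp add: Suc field_simps)
        then have "(real j + 1 + real c) / (real j + 2) / (real j + 1) \<le> (real c + 1) / 2 / (real j + 1)"
          by (rule divide_right_mono) simp
        then have "(real j + 1 + real c) / ((real j + 1) * (real j + 2)) \<le> (real c + 1) / 2 / (real j + 1)"
          by (simp add: mult.commute)
        then show ?thesis using D[of c] by (rule mult_right_mono)
      qed simp
    qed (simp_all add: add_divide_distrib)
    also have "\<dots> = env_const \<delta> c / 2 ^ c + \<kappa> c / (real j + 1)"
      unfolding \<kappa>_def by (rule alg')
    finally show ?thesis .
  qed
  have c1: "env_const \<delta> (Suc c) = env_const \<delta> c + \<delta> * (env_const \<delta> c / 2 ^ c) + env_const \<delta> (Suc c) / 2 ^ Suc c"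
    using env_const_step[of \<delta> c] by (simp add: algebra_simps del: env_const.simps)
  have s1: "env_slope \<delta> (Suc c) = env_slope \<delta> c + \<delta> * \<kappa> c + \<kappa> (Suc c)"
  proof -
    have "\<kappa> (Suc c) = (real c + 1) * env_const \<delta> (Suc c) / 2 ^ Suc c
        + env_slope \<delta> (Suc c) * ((real c + 2) / 2 ^ (c + 2))"
      by (simp add: \<kappa>_def field_simps del: env_const.simps env_slope.simps)
    moreover have "env_slope \<delta> (Suc c) - env_slope \<delta> (Suc c) * ((real c + 2) / 2 ^ (c + 2))
        = env_slope \<delta> c + \<delta> * \<kappa> c + (real c + 1) * env_const \<delta> (Suc c) / 2 ^ Suc c"
      using env_slope_step[of \<delta> c] by (simp only: \<kappa>_def right_diff_distrib mult_1_right times_divide_eq_right)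
    ultimately show ?thesis by linarith
  qed
  have "H c j + \<delta> * (chain_ratio (j + c) / chain_ratio j * H c (Suc j))
           + chain_ratio (j + Suc c) / chain_ratio j * H (Suc c) (Suc j)
       \<le> H c j + \<delta> * (env_const \<delta> c / 2 ^ c + \<kappa> c / (real j + 1))
           + (env_const \<delta> (Suc c) / 2 ^ Suc c + \<kappa> (Suc c) / (real j + 1))"
    by (intro add_mono order_refl mult_left_mono bound assms)
  also have "\<dots> = (env_const \<delta> c + \<delta> * (env_const \<delta> c / 2 ^ c) + env_const \<delta> (Suc c) / 2 ^ Suc c)
         + (env_slope \<delta> c + \<delta> * \<kappa> c + \<kappa> (Suc c)) / (real j + 1)"
    by (simp add: H_def add_divide_distrib distrib_left del: env_const.simps env_slope.simps)
  also have "\<dots> = H (Suc c) j"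
    by (simp only: H_def c1[symmetric] s1[symmetric])
  finally show ?thesis .
qed

text \<open>\<open>A\<close> and \<open>D\<close> are proposed bounds for the limits. The amounts
  subtracted at index \<open>n\<close> are the tail sums over \<open>i \<ge> n\<close> of the
  increment bounds \<open>(1 + 2 * \<delta>) * A / 2 ^ (i + 1)\<close> and
  \<open>((i + 1) * \<beta> + D / 2) / 2 ^ (i + 1)\<close>. Hence a check at index 8 suffices;
  monotonicity covers smaller indices.\<close>

lemma env_tail:
  fixes \<delta> A D :: real
  defines "\<beta> \<equiv> (1 + 2 * \<delta>) * (A + D / 2)"
  assumes "\<delta> \<ge> 0" "A \<ge> 0" "D \<ge> 0"
    and A8: "env_const \<delta> 8 \<le> A - (1 + 2 * \<delta>) * A / 2 ^ 8"
    and D8: "env_slope \<delta> 8 \<le> D - (8 * \<beta> + 2 * \<beta> + D / 2) / 2 ^ 8"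
  shows "env_const \<delta> c + env_slope \<delta> c \<le> A + D"
proof -
  have \<beta>: "\<beta> \<ge> 0" using assms by (simp add: \<beta>_def)
  have tail: "env_const \<delta> n \<le> A - (1 + 2 * \<delta>) * A * (1 / 2 ^ n)
      \<and> env_slope \<delta> n \<le> D - (real n * \<beta> + 2 * \<beta> + D / 2) * (1 / 2 ^ n)" if "8 \<le> n" for n
    using that
  proof (induction n rule: dec_induct)
    case base
    show ?case using A8 D8 by simp
  next
    case (step n)
    define e where "e = 1 / (2::real) ^ Suc n"
    have e: "e > 0" "1 / 2 ^ n = 2 * e" "1 / 2 ^ (n + 2) = e / 2" by (simp_all add: e_def)
    have a: "env_const \<delta> n \<le> A - (1 + 2 * \<delta>) * A * (2 * e)"
      and d: "env_slope \<delta> n \<le> D - (real n * \<beta> + 2 * \<beta> + D / 2) * (2 * e)"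
      using step.IH unfolding e(2) by blast+
    have "env_const \<delta> (Suc n) * (1 - e) = (1 + \<delta> * (1 / 2 ^ n)) * env_const \<delta> n"
      using env_const_step[of \<delta> n] by (simp add: e_def del: env_const.simps)
    also have "\<dots> \<le> (1 + \<delta> * (2 * e)) * (A - (1 + 2 * \<delta>) * A * (2 * e))"
      unfolding e(2) using a assms(2) e(1) by (intro mult_left_mono) auto
    also have "\<dots> \<le> (A - (1 + 2 * \<delta>) * A * e) * (1 - e)"
    proof -
      have "0 \<le> (1 + 2 * \<delta>) * A * e * e * (1 + 4 * \<delta>)"
        using assms e by simp
      then show ?thesis by (simp add: algebra_simps)
    qed
    finally have a': "env_const \<delta> (Suc n) \<le> A - (1 + 2 * \<delta>) * A * e"
      using env_const_denominator[of n] unfolding e_def[symmetric] by (rule mult_right_le_imp_le)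
    have "0 \<le> (1 + 2 * \<delta>) * A * e" "0 \<le> (1 + 2 * \<delta>) * A * (2 * e)"
      "0 \<le> (real n * \<beta> + 2 * \<beta> + D / 2) * (2 * e)"
      using assms \<beta> e by auto
    then have le: "env_const \<delta> (Suc n) \<le> A" "env_const \<delta> n \<le> A" "env_slope \<delta> n \<le> D"
      using a a' d by linarith+
    define T where "T = D - (real (Suc n) * \<beta> + 2 * \<beta> + D / 2) * e"
    have "env_slope \<delta> (Suc n) * (1 - (real n + 2) * (e / 2))
      = env_slope \<delta> n + \<delta> * (real n * env_const \<delta> n + (real n + 1) / 2 * env_slope \<delta> n) * (2 * e)
        + (real n + 1) * env_const \<delta> (Suc n) * e"
      using env_slope_step[of \<delta> n] unfolding e(2,3)[symmetric] e_def
      by (simp del: env_const.simps env_slope.simps)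
    also have "\<dots> \<le> (D - (real n * \<beta> + 2 * \<beta> + D / 2) * (2 * e))
        + \<delta> * (real n * A + (real n + 1) / 2 * D) * (2 * e) + (real n + 1) * A * e"
      using d le assms e(1) by (intro add_mono mult_right_mono mult_left_mono) auto
    also have "\<dots> = T - D * ((real n + 2) * (e / 2)) - 2 * \<delta> * A * e"
      by (simp add: T_def \<beta>_def field_simps)
    also have "\<dots> \<le> T - T * ((real n + 2) * (e / 2))"
    proof -
      have "T \<le> D" using assms \<beta> e(1) by (simp add: T_def)
      then have "T * ((real n + 2) * (e / 2)) \<le> D * ((real n + 2) * (e / 2))"
        using e(1) by (intro mult_right_mono) auto
      moreover have "0 \<le> 2 * \<delta> * A * e" using assms e(1) by simp
      ultimately show ?thesis by linarith
    qed
    also have "\<dots> = T * (1 - (real n + 2) * (e / 2))" by (simp add: algebra_simps)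
    finally have "env_slope \<delta> (Suc n) \<le> T"
      by (rule mult_right_le_imp_le) (use env_slope_denominator[of n] in \<open>simp add: e_def power_add\<close>)
    with a' show ?case unfolding T_def e_def by blast
  qed
  have "env_const \<delta> c \<le> env_const \<delta> (c + 8)" "env_slope \<delta> c \<le> env_slope \<delta> (c + 8)"
    using env_mono[OF assms(2)] by (auto intro: monoD)
  moreover have "0 \<le> (1 + 2 * \<delta>) * A * (1 / 2 ^ (c + 8))"
    "0 \<le> (real (c + 8) * \<beta> + 2 * \<beta> + D / 2) * (1 / 2 ^ (c + 8))"
    using assms \<beta> by auto
  ultimately show ?thesis using tail[of "c + 8"] by linarith
qed

section \<open>The first moment over two cliques\<close>

lemma sum_chain_ratio_double_clique:
  "(\<Sum>S | S \<subseteq> {..<2 * N} \<and> card S = s. \<Prod>v\<in>S. chain_ratio (card (nbrs_before N v \<inter> S)))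
     = (\<Sum>a\<le>s. chain_weight a * level_sum N 0 0 a (s - a))"
proof -
  let ?w = "\<lambda>S. \<Prod>v\<in>S. chain_ratio (card (nbrs_before N v \<inter> S))"
  have U: "levels_from N 0 = {..<2 * N}" by (auto simp: levels_from_def)
  have summand: "(\<Sum>a\<le>s. chain_weight a * split_weight N 0 a (s - a) S) = (if card S = s then ?w S else 0)"
    if "S \<in> Pow {..<2 * N}" for S
  proof -
    have fin: "finite S" using that finite_subset by auto
    have card: "card S = card (S \<inter> {..<N}) + card (S - {..<N})"
      by (rule card_Int_Diff[OF fin])
    have w: "?w S = chain_weight (card (S \<inter> {..<N})) * (\<Prod>v\<in>S - {..<N}. chain_ratio (card (nbrs_before N v \<inter> S)))"
      by (simp add: prod.Int_Diff[OF fin, of _ "{..<N}"] prod_chain_ratio_clique[OF fin])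
    have "(\<Sum>a\<le>s. chain_weight a * split_weight N 0 a (s - a) S)
        = (\<Sum>a\<le>s. if a = card (S \<inter> {..<N}) then (if card S = s then ?w S else 0) else 0)"
      by (rule sum.cong) (auto simp: split_weight_def w card)
    then show ?thesis by (simp add: card)
  qed
  have "(\<Sum>a\<le>s. chain_weight a * level_sum N 0 0 a (s - a))
      = (\<Sum>S\<in>Pow {..<2 * N}. \<Sum>a\<le>s. chain_weight a * split_weight N 0 a (s - a) S)"
    unfolding level_sum_def U sum_distrib_left by (rule sum.swap)
  also have "\<dots> = (\<Sum>S\<in>Pow {..<2 * N}. if card S = s then ?w S else 0)"
    by (intro sum.cong refl summand)
  also have "\<dots> = (\<Sum>S\<in>{S \<in> Pow {..<2 * N}. card S = s}. ?w S)"
    by (rule sum.inter_filter[symmetric]) simp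
  finally show ?thesis by (simp add: Pow_def)
qed

text \<open>With the binomials dominated by a geometric sequence, the supersolution applies; its
  value at \<open>j = 0\<close> is at most \<open>L\<close>.\<close>

lemma sum_chain_ratio_double_clique_le:
  assumes "\<delta> \<ge> 0" and L: "\<And>c. env_const \<delta> c + env_slope \<delta> c \<le> L"
    and B: "\<And>t. real ((N + t) choose s) \<le> B * (1 + \<delta>) ^ t"
  shows "(\<Sum>S | S \<subseteq> {..<2 * N} \<and> card S = s. \<Prod>v\<in>S. chain_ratio (card (nbrs_before N v \<inter> S)))
     \<le> B * L * (\<Sum>a\<le>s. chain_weight a * chain_weight (s - a))"
proof -
  have B0: "B \<ge> 0" using order_trans[OF of_nat_0_le_iff B[of 0]] by simp
  have level: "level_sum N 0 0 a (s - a) \<le> B * (chain_weight (s - a) * L)" if "a \<le> s" for a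
  proof -
    let ?H = "\<lambda>c j. env_const \<delta> c + env_slope \<delta> c / (real j + 1)"
    have "level_sum N 0 0 a (s - a) \<le> word_sum False (\<lambda>t. real ((N + t) choose s)) 0 a (s - a)"
      using level_sum_le_word_sum[of N N 0 a "s - a"] that by simp
    also have "\<dots> \<le> word_sum False (\<lambda>t. B * (1 + \<delta>) ^ t) 0 a (s - a)"
      by (rule word_sum_mono) (rule B)
    also have "\<dots> = B * word_sum False (\<lambda>t. (1 + \<delta>) ^ t) 0 a (s - a)"
      by (rule word_sum_cmult)
    also have "\<dots> \<le> B * ((\<Prod>i<s - a. chain_ratio (0 + i)) * ?H a 0)"
    proof (intro mult_left_mono B0 conjunct1[OF word_sum_power_le])
      show "1 \<le> ?H a j" for a j
        using env_const_ge_1[OF assms(1), of a] env_slope_nonneg[OF assms(1), of a]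
        by (simp add: add_increasing2)
      show "?H a j + \<delta> * (chain_ratio (j + a) / chain_ratio j * ?H a (Suc j))
           + chain_ratio (j + Suc a) / chain_ratio j * ?H (Suc a) (Suc j) \<le> ?H (Suc a) j" for a j
        by (rule env_supersolution[OF assms(1)])
    qed (use assms(1) in auto)
    also have "\<dots> \<le> B * (chain_weight (s - a) * L)"
      using L[of a] chain_weight_pos[of "s - a"] B0
      by (intro mult_left_mono) (auto simp: chain_weight_def[symmetric] intro!: mult_left_mono)
    finally show ?thesis .
  qed
  have "(\<Sum>a\<le>s. chain_weight a * level_sum N 0 0 a (s - a))
      \<le> (\<Sum>a\<le>s. chain_weight a * (B * (chain_weight (s - a) * L)))"
    using chain_weight_pos level by (intro sum_mono mult_left_mono) (auto intro: less_imp_le)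
  also have "\<dots> = B * L * (\<Sum>a\<le>s. chain_weight a * chain_weight (s - a))"
    by (simp add: sum_distrib_left mult_ac)
  finally show ?thesis unfolding sum_chain_ratio_double_clique .
qed

text \<open>Yields the halving of consecutive terms in the convolution below. The case
  \<open>n = d = 0\<close> is excluded because \<open>chain_ratio 2 = 3 / 4\<close>.\<close>

lemma chain_ratio_shift_le_half:
  assumes "d > 0 \<or> n > 0"
  shows "chain_ratio (n + 2 * d + 2) \<le> chain_ratio n / 2"
proof -
  have "n + 2 * d + 3 \<le> (n + 1) * 2 ^ (2 * d + 1)"
  proof (cases d)
    case 0
    with assms show ?thesis by simp
  next
    case (Suc d')
    have "2 * d + 3 \<le> (2::nat) ^ (2 * d + 1)"
      unfolding Suc by (induction d') auto
    moreover have "n * 1 \<le> n * 2 ^ (2 * d + 1)" by (intro mult_le_mono2) simp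
    ultimately show ?thesis unfolding add_mult_distrib by linarith
  qed
  then have le: "real (n + 2 * d + 3) \<le> real ((n + 1) * 2 ^ (2 * d + 1))"
    by (rule of_nat_mono)
  have "chain_ratio (n + 2 * d + 2) = real (n + 2 * d + 3) / (2 ^ (2 * d + 1) * 2 ^ Suc n)"
    by (simp add: chain_ratio_def power_add add_ac mult_ac)
  also have "\<dots> \<le> real ((n + 1) * 2 ^ (2 * d + 1)) / (2 ^ (2 * d + 1) * 2 ^ Suc n)"
    using le by (rule divide_right_mono) simp
  also have "\<dots> = chain_ratio n / 2"
    by (simp add: chain_ratio_def field_simps)
  finally show ?thesis .
qed

text \<open>The two central terms agree, and each step outwards at least halves a term. Two
  geometric series add up to four central terms.\<close>

lemma sum_chain_weight_convolution_le:
  assumes "m \<ge> 2"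
  shows "(\<Sum>a\<le>4 * m - 1. chain_weight a * chain_weight (4 * m - 1 - a))
           \<le> 4 * (chain_weight (2 * m) * chain_weight (2 * m - 1))"
proof -
  \<comment> \<open>\<open>d\<close> is the distance of the index from \<open>2 * m\<close>; the
    mirrored index \<open>2 * m - 1 - d\<close> gives the same term.\<close>
  define p where "p d = chain_weight (2 * m + d) * chain_weight (2 * m - 1 - d)" for d
  have p0: "p d > 0" for d by (simp add: p_def chain_weight_pos)
  have geo: "p d \<le> p 0 * (1 / 2) ^ d" if "d < 2 * m" for d
    using that
  proof (induction d)
    case (Suc d)
    define n where "n = 2 * m - 2 - d"
    have n: "2 * m - 1 - d = Suc n" "2 * m - 1 - Suc d = n" "2 * m + d = n + 2 * d + 2"
      using Suc.prems by (auto simp: n_def)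
    have "p (Suc d) = chain_weight (n + 2 * d + 2) * chain_weight n * chain_ratio (n + 2 * d + 2)"
      unfolding p_def n(2) add_Suc_right n(3) chain_weight_Suc by simp
    also have "\<dots> \<le> chain_weight (n + 2 * d + 2) * chain_weight n * (chain_ratio n / 2)"
      using assms chain_weight_pos
      by (intro mult_left_mono chain_ratio_shift_le_half mult_nonneg_nonneg less_imp_le)
        (auto simp: n_def)
    also have "\<dots> = p d * (1 / 2)"
      unfolding p_def n(1,3) chain_weight_Suc by simp
    also have "\<dots> \<le> p 0 * (1 / 2) ^ d * (1 / 2)"
      using Suc by (intro mult_right_mono) auto
    finally show ?case by simp
  qed simp
  have "(\<Sum>d<2 * m. p d) \<le> (\<Sum>d<2 * m. p 0 * (1 / 2) ^ d)"
    by (intro sum_mono geo) simp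
  also have "\<dots> = p 0 * (\<Sum>d<2 * m. (1 / 2) ^ d)" by (simp add: sum_distrib_left)
  also have "(\<Sum>d<2 * m. (1 / 2 :: real) ^ d) \<le> 2"
    by (subst sum_gp_strict) (auto simp: field_simps)
  finally have half: "(\<Sum>d<2 * m. p d) \<le> 2 * p 0" using p0[of 0] by simp
  have set: "{..4 * m - 1} = {..<2 * m} \<union> {2 * m..<4 * m}" using assms by auto
  have "(\<Sum>a\<le>4 * m - 1. chain_weight a * chain_weight (4 * m - 1 - a))
      = (\<Sum>a<2 * m. chain_weight a * chain_weight (4 * m - 1 - a))
        + (\<Sum>a=2 * m..<4 * m. chain_weight a * chain_weight (4 * m - 1 - a))"
    unfolding set by (rule sum.union_disjoint) auto
  also have "(\<Sum>a<2 * m. chain_weight a * chain_weight (4 * m - 1 - a)) = (\<Sum>d<2 * m. p d)"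
    by (rule sum.reindex_bij_witness[of _ "\<lambda>d. 2 * m - 1 - d" "\<lambda>a. 2 * m - 1 - a"])
      (auto simp: p_def mult.commute)
  also have "(\<Sum>a=2 * m..<4 * m. chain_weight a * chain_weight (4 * m - 1 - a)) = (\<Sum>d<2 * m. p d)"
    by (rule sum.reindex_bij_witness[of _ "\<lambda>d. 2 * m + d" "\<lambda>a. a - 2 * m"])
      (auto simp: p_def)
  finally show ?thesis using half by (simp add: p_def)
qed

text \<open>\<open>y\<close> is the ratio of the binomials at \<open>M + 2\<close> and
  \<open>M + 1\<close>. Such ratios decrease in the upper index, which settles
  \<open>t \<ge> 1\<close>, while the ratio from \<open>M\<close> to \<open>M + 1\<close> is at
  least \<open>y\<close>, which settles \<open>t = 0\<close>.\<close>

lemma binomial_shift_le_geometric: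
  fixes M s t :: nat
  defines "y \<equiv> (real M + 2) / (real M + 2 - real s)"
  assumes "s \<le> M"
  shows "real ((M + t) choose s) \<le> real (Suc M choose s) / y * y ^ t"
proof -
  have y: "y > 0" using assms(2) by (simp add: y_def)
  have absorb: "real (Suc n choose s) * (real n + 1 - real s) = real (n choose s) * (real n + 1)"
    if "s \<le> n" for n
  proof -
    have "(Suc n - s) * (Suc n choose s) = Suc n * (n choose s)"
      using binomial_absorb_comp[of "Suc n" s] by simp
    then have "real (Suc n - s) * real (Suc n choose s) = real (Suc n) * real (n choose s)"
      by (metis of_nat_mult)
    then show ?thesis using that by (simp add: of_nat_diff mult.commute add.commute)
  qed
  show ?thesis
  proof (cases t)
    case 0
    have "real (M choose s) = real (Suc M choose s) * ((real M + 1 - real s) / (real M + 1))"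
      using absorb[OF assms(2)] by (simp add: field_simps)
    also have "\<dots> \<le> real (Suc M choose s) * ((real M + 2 - real s) / (real M + 2))"
      using assms(2) by (intro mult_left_mono) (auto simp: field_simps)
    finally show ?thesis by (simp add: 0 y_def)
  next
    case (Suc u)
    have "real ((Suc M + u) choose s) \<le> real (Suc M choose s) * y ^ u"
    proof (induction u)
      case (Suc u)
      define n where "n = Suc M + u"
      have n: "s \<le> n" "real n + 1 - real s > 0" using assms(2) by (auto simp: n_def)
      have "real (Suc n choose s) = real (n choose s) * ((real n + 1) / (real n + 1 - real s))"
        using absorb[OF n(1)] n(2) by (simp add: field_simps)
      also have "(real n + 1) / (real n + 1 - real s) \<le> y"
        using assms(2) n(2) by (simp add: y_def n_def divide_simps) (simp add: algebra_simps)
      then have "real (n choose s) * ((real n + 1) / (real n + 1 - real s)) \<le> real (n choose s) * y"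
        by (intro mult_left_mono) auto
      also have "\<dots> \<le> real (Suc M choose s) * y ^ u * y"
        using Suc y by (intro mult_right_mono) (auto simp: n_def)
      finally show ?case by (simp add: n_def mult_ac)
    qed simp
    with y show ?thesis by (simp add: Suc)
  qed
qed

lemma choose_two_double: "((2 * m) choose 2) + ((2 * m - 1) choose 2) = (2 * m - 1)\<^sup>2"
proof (cases m)
  case (Suc r)
  have "(2 * m) choose 2 = (r + 1) * (2 * r + 1)"
    by (simp add: choose_two Suc algebra_simps)
  moreover have "(2 * m - 1) choose 2 = r * (2 * r + 1)"
    by (simp add: choose_two Suc algebra_simps)
  ultimately show ?thesis by (simp add: Suc power2_eq_square algebra_simps)
qed (simp add: numeral_2_eq_2)

text \<open>\<open>num\<close> is the first-moment inequality cleared of denominators: 4 comes from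
  the convolution, \<open>L\<close> from the interleavings, and \<open>(M + 2) / (M + 2 - s)\<close>
  is the geometric ratio.\<close>

lemma sparse_orientable_double:
  fixes m N L :: nat and \<delta> :: real
  defines "M \<equiv> 2 ^ m" and "s \<equiv> 4 * m - 1"
  assumes "m \<ge> 2" "N \<le> M" "s \<le> M" "\<delta> \<ge> 0" "real (M + 2) \<le> (1 + \<delta>) * real (M + 2 - s)"
    and L: "\<And>c. env_const \<delta> c + env_slope \<delta> c \<le> real L"
    and num: "4 * L * (fact s * (Suc M choose s)) * (M + 2 - s)
                < (M + 2) * ((s choose (2 * m)) * 2 ^ (2 * m - 1)\<^sup>2)"
  shows "sparse_orientable N (2 * N) (4 * m - 2)"
proof (rule sparse_orientable_first_moment)
  define y where "y = (real M + 2) / (real M + 2 - real s)"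
  have s: "Suc (4 * m - 2) = s" using assms(3) by (simp add: s_def)
  have Ms: "real (M + 2 - s) = real M + 2 - real s" "real M + 2 - real s > 0" using assms(5) by simp_all
  have y: "y > 0" using Ms by (simp add: y_def)
  define B where "B = real (Suc M choose s) / y"
  have B0: "B \<ge> 0" using y by (simp add: B_def)
  have "(\<Sum>S | S \<subseteq> {..<2 * N} \<and> card S = s. \<Prod>v\<in>S. chain_ratio (card (nbrs_before N v \<inter> S)))
      \<le> B * real L * (\<Sum>a\<le>s. chain_weight a * chain_weight (s - a))"
  proof (rule sum_chain_ratio_double_clique_le[OF assms(6) L])
    fix t
    have "real ((N + t) choose s) \<le> real ((M + t) choose s)"
      using assms(4) by (intro of_nat_mono binomial_right_mono) simp
    also have "\<dots> \<le> B * y ^ t"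
      unfolding B_def y_def by (rule binomial_shift_le_geometric) (rule assms(5))
    also have "\<dots> \<le> B * (1 + \<delta>) ^ t"
    proof -
      have "y \<le> 1 + \<delta>" using assms(7) Ms by (simp add: y_def pos_divide_le_eq add_ac)
      then show ?thesis using y B0 by (intro mult_left_mono power_mono) auto
    qed
    finally show "real ((N + t) choose s) \<le> B * (1 + \<delta>) ^ t" .
  qed
  also have "\<dots> \<le> B * real L * (4 * (chain_weight (2 * m) * chain_weight (2 * m - 1)))"
    using B0 sum_chain_weight_convolution_le[OF assms(3)] unfolding s_def
    by (intro mult_left_mono) auto
  also have "\<dots> = 4 * real L * (real (Suc M choose s) * (chain_weight (2 * m) * chain_weight (2 * m - 1))) / y"
    by (simp add: B_def)
  \<comment> \<open>The division by \<open>s choose (2 * m)\<close> is the gain from fixing the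
    interleaving.\<close>
  also have "\<dots> = 4 * real L * real (fact s * (Suc M choose s)) / (real (s choose (2 * m)) * 2 ^ (2 * m - 1)\<^sup>2) / y"
  proof -
    have "fact (2 * m) * fact (s - 2 * m) * (s choose (2 * m)) = (fact s :: nat)"
      using assms(3) by (intro binomial_fact_lemma) (simp add: s_def)
    moreover have "s - 2 * m = 2 * m - 1" using assms(3) by (simp add: s_def)
    ultimately have "real (fact s) = fact (2 * m) * fact (2 * m - 1) * real (s choose (2 * m))"
      by (metis of_nat_fact of_nat_mult)
    moreover have "real (s choose (2 * m)) > 0" using assms(3) by (simp add: s_def)
    ultimately show ?thesis
      unfolding chain_weight_eq choose_two_double[symmetric] power_add by (simp add: mult_ac)
  qed
  also have "\<dots> < 1"
  proof -
    have "y * (real (s choose (2 * m)) * 2 ^ (2 * m - 1)\<^sup>2) > 0"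
      using y assms(3) by (simp add: s_def)
    moreover have "4 * real L * real (fact s * (Suc M choose s)) * (real M + 2 - real s)
        < (real M + 2) * (real (s choose (2 * m)) * 2 ^ (2 * m - 1)\<^sup>2)"
      using of_nat_less_iff[where 'a = real, THEN iffD2, OF num]
      by (simp only: of_nat_mult of_nat_power of_nat_numeral of_nat_add Ms(1))
    then have "4 * real L * real (fact s * (Suc M choose s)) < y * (real (s choose (2 * m)) * 2 ^ (2 * m - 1)\<^sup>2)"
      using Ms(2) by (simp add: y_def pos_less_divide_eq)
    ultimately show ?thesis by (simp add: mult_ac)
  qed
  finally show "(\<Sum>S | S \<subseteq> {..<2 * N} \<and> card S = Suc (4 * m - 2).
      \<Prod>v\<in>S. chain_ratio (card (nbrs_before N v \<inter> S))) < 1"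
    unfolding s .
qed

section \<open>Numerical bounds\<close>

text \<open>Both recursions are monotone in the preceding values, so a table satisfying them as
  inequalities stays above the true values.\<close>

lemma env_le_table:
  assumes "\<delta> \<ge> 0" "1 \<le> As ! 0" "0 \<le> Ds ! 0"
    and step: "\<forall>c<n. (1 + \<delta> / 2 ^ c) * As ! c \<le> As ! Suc c * (1 - 1 / 2 ^ Suc c) \<and>
      Ds ! c + \<delta> * (real c * As ! c + (real c + 1) / 2 * Ds ! c) / 2 ^ c + (real c + 1) * As ! Suc c / 2 ^ Suc c
        \<le> Ds ! Suc c * (1 - (real c + 2) / 2 ^ (c + 2))"
  shows "env_const \<delta> n \<le> As ! n \<and> env_slope \<delta> n \<le> Ds ! n"
  using step
proof (induction n)
  case 0
  show ?case using assms(2,3) by simp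
next
  case (Suc n)
  then have IH: "env_const \<delta> n \<le> As ! n" "env_slope \<delta> n \<le> Ds ! n" by auto
  have "env_const \<delta> (Suc n) * (1 - 1 / 2 ^ Suc n) \<le> (1 + \<delta> / 2 ^ n) * As ! n"
    unfolding env_const_step using IH assms(1) by (intro mult_left_mono) auto
  also have "\<dots> \<le> As ! Suc n * (1 - 1 / 2 ^ Suc n)" using Suc.prems by blast
  finally have A: "env_const \<delta> (Suc n) \<le> As ! Suc n"
    using env_const_denominator[of n] by (rule mult_right_le_imp_le)
  have "env_slope \<delta> (Suc n) * (1 - (real n + 2) / 2 ^ (n + 2))
      \<le> Ds ! n + \<delta> * (real n * As ! n + (real n + 1) / 2 * Ds ! n) / 2 ^ n + (real n + 1) * As ! Suc n / 2 ^ Suc n"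
    unfolding env_slope_step using IH A assms(1)
    by (intro add_mono divide_right_mono mult_left_mono) auto
  also have "\<dots> \<le> Ds ! Suc n * (1 - (real n + 2) / 2 ^ (n + 2))" using Suc.prems by blast
  finally have "env_slope \<delta> (Suc n) \<le> Ds ! Suc n"
    using env_slope_denominator[of n] by (rule mult_right_le_imp_le)
  with A show ?case by blast
qed

text \<open>The lists are the values of \<open>env_const\<close> and \<open>env_slope\<close> rounded upwards; \<open>\<delta>\<close> has to be at least
  \<open>(4 m - 1) / (2 ^ m + 3 - 4 m)\<close>.\<close>

lemma env_le_5: "env_const 5 c + env_slope 5 c \<le> 19580"
proof -
  have "env_const 5 8 \<le> [1, 12, 56, 144, 250, 339, 399, 434, 453] ! 8
      \<and> env_slope 5 8 \<le> [0, 12, 160, 872, 2720, 5750, 9254, 12383, 14710] ! 8"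
    by (rule env_le_table) (simp_all add: eval_nat_numeral All_less_Suc)
  then show ?thesis using env_tail[of 5 480 19100 c] by simp
qed

lemma env_le_4_3: "env_const (4 / 3) c + env_slope (4 / 3) c \<le> 372"
proof -
  have "env_const (4 / 3) 8 \<le> [1, 5, 12, 19, 24, 27, 29, 30, 31] ! 8
      \<and> env_slope (4 / 3) 8 \<le> [0, 5, 29, 79, 144, 206, 254, 287, 308] ! 8"
    by (rule env_le_table) (simp_all add: eval_nat_numeral All_less_Suc)
  then show ?thesis using env_tail[of "4 / 3" 32 340 c] by simp
qed

lemma env_le_3_5: "env_const (3 / 5) c + env_slope (3 / 5) c \<le> 86"
proof -
  have "env_const (3 / 5) 8 \<le> [1, 16/5, 28/5, 37/5, 43/5, 47/5, 49/5, 10, 51/5] ! 8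
      \<and> env_slope (3 / 5) 8 \<le> [0, 16/5, 64/5, 27, 207/5, 266/5, 307/5, 333/5, 349/5] ! 8"
    by (rule env_le_table) (simp_all add: eval_nat_numeral All_less_Suc)
  then show ?thesis using env_tail[of "3 / 5" "21 / 2" 75 c] by simp
qed

lemma env_le_1_7: "env_const (1 / 7) c + env_slope (1 / 7) c \<le> 29"
proof -
  have "env_const (1 / 7) 8 \<le> [1, 23/10, 33/10, 79/20, 43/10, 9/2, 23/5, 93/20, 47/10] ! 8
      \<and> env_slope (1 / 7) 8 \<le> [0, 23/10, 137/20, 239/20, 81/5, 77/4, 106/5, 112/5, 231/10] ! 8"
    by (rule env_le_table) (simp_all add: eval_nat_numeral All_less_Suc)
  then show ?thesis using env_tail[of "1 / 7" "19 / 4" "97 / 4" c] by simp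
qed

text \<open>Each increment of \<open>m\<close> gains a factor of at least 8. The constant 120 is
  chosen above \<open>4 * 29\<close>, and \<open>3 * m - 1\<close> equals
  \<open>m * (4 * m - 1) - (2 * m - 1) ^ 2\<close>, the exponent left over in the large
  case.\<close>

lemma binomial_central_ge:
  assumes "m \<ge> 10"
  shows "120 * 2 ^ (3 * m - 1) \<le> (4 * m - 1) choose (2 * m)"
  using assms
proof (induction m rule: dec_induct)
  case base
  have "120 * 2 ^ 29 \<le> (39::nat) choose 20" by (simp add: binomial_fact' fact_numeral)
  then show ?case by simp
next
  case (step m)
  define n where "n = 4 * m - 1"
  define j where "j = 2 * m - 1"
  have nj: "4 * m - 1 = n" "2 * m = Suc j" "4 * Suc m - 1 = Suc (Suc (Suc (Suc n)))" "2 * Suc m = Suc (Suc (Suc j))"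
    "3 * Suc m - 1 = 3 * m - 1 + 3"
    using step by (auto simp: n_def j_def)
  \<comment> \<open>\<open>n = 2 * j + 1\<close>, so the two middle coefficients agree and Pascal's
    rule collects at least eight copies.\<close>
  have "n choose j = n choose Suc j"
    using binomial_symmetric[of j n] step by (simp add: n_def j_def)
  moreover have "n choose j \<le> Suc n choose j" by (rule binomial_right_mono) simp
  ultimately have "8 * (n choose Suc j) \<le> Suc (Suc (Suc (Suc n))) choose Suc (Suc (Suc j))"
    by simp
  moreover have "120 * 2 ^ (3 * m - 1) \<le> n choose Suc j"
    using step.IH unfolding nj(1,2) .
  ultimately have "120 * (2 ^ (3 * m - 1) * 8) \<le> Suc (Suc (Suc (Suc n))) choose Suc (Suc (Suc j))"
    by linarith
  then show ?case unfolding nj power_add by (simp del: binomial_Suc_Suc)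
qed

section \<open>Falling factorials and the verification for each exponent\<close>

lemma fact_mult_binomial_absorb:
  "fact (Suc t) * (Suc n choose Suc t) = Suc n * (fact t * (n choose t))"
proof -
  have "fact (Suc t) * (Suc n choose Suc t) = fact t * (Suc t * (Suc n choose Suc t))"
    by (simp only: fact_Suc of_nat_id mult_ac)
  then show ?thesis by (simp only: Suc_times_binomial mult_ac)
qed

text \<open>Unfolds a falling factorial into a product of numerals for the checks with
  \<open>m \<le> 9\<close>.\<close>

lemma fact_mult_binomial_numeral:
  "fact (numeral k) * (numeral n choose numeral k)
     = numeral n * (fact (pred_numeral k) * (pred_numeral n choose pred_numeral k))"
  unfolding numeral_eq_Suc by (rule fact_mult_binomial_absorb)

text \<open>In this falling factorial only \<open>M + 1\<close> exceeds \<open>M\<close>, and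
  \<open>(M + 1) * (M - 1) \<le> M ^ 2\<close>; for \<open>s \<ge> 3\<close> both factors
  occur.\<close>

lemma fact_mult_binomial_Suc_le:
  assumes "s \<ge> 3" "M \<ge> 1"
  shows "fact s * (Suc M choose s) \<le> M ^ s"
proof -
  obtain r where r: "s = Suc (Suc (Suc r))" using assms(1) by (metis Suc_le_D numeral_3_eq_3 Suc_le_mono)
  obtain K where K: "M = Suc K" using assms(2) by (cases M) auto
  have "fact s * (Suc M choose s) = Suc M * (M * ((K choose Suc r) * fact (Suc r)))"
    unfolding r fact_mult_binomial_absorb unfolding K fact_mult_binomial_absorb by (simp only: mult_ac)
  also have "\<dots> \<le> Suc M * (M * K ^ Suc r)"
    by (intro mult_le_mono2 binomial_fact_pow)
  also have "\<dots> = (Suc M * K) * (M * K ^ r)" by (simp only: power_Suc mult_ac)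
  also have "\<dots> \<le> (M * M) * (M * M ^ r)"
  proof (rule mult_le_mono)
    show "Suc M * K \<le> M * M" by (simp add: K)
    show "M * K ^ r \<le> M * M ^ r" by (intro mult_le_mono2 power_mono) (simp_all add: K)
  qed
  also have "\<dots> = M ^ s" by (simp add: r)
  finally show ?thesis .
qed

text \<open>\<open>8 * (4 * m - 1) \<le> 2 ^ m\<close> keeps the geometric ratio below
  \<open>8 / 7\<close>. The falling factorial is at most \<open>(2 ^ m) ^ (4 * m - 1)\<close>, and
  \<open>4 * 29 < 120\<close> gives strictness.\<close>

lemma sparse_orientable_double_large:
  assumes "m \<ge> 10" "N \<le> 2 ^ m"
  shows "sparse_orientable N (2 * N) (4 * m - 2)"
proof -
  let ?s = "4 * m - 1"
  have M: "8 * ?s \<le> 2 ^ m"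
    using assms(1) by (induction m rule: dec_induct) auto
  show ?thesis
  proof (rule sparse_orientable_double[where \<delta> = "1 / 7" and L = 29])
    have "real (M + 2) \<le> (1 + 1 / 7) * real (M + 2 - s)" if "8 * s \<le> M" for M s :: nat
    proof -
      have "8 * real s \<le> real M" using of_nat_mono[OF that, where 'a = real] by simp
      moreover have "real (M + 2 - s) = real M + 2 - real s" using that by (simp add: of_nat_diff)
      ultimately show ?thesis by simp
    qed
    from this[OF M] show "real (2 ^ m + 2) \<le> (1 + 1 / 7) * real (2 ^ m + 2 - ?s)" .
    have "4 * 29 * (fact ?s * (Suc (2 ^ m) choose ?s)) * (2 ^ m + 2 - ?s)
        \<le> (2 ^ m + 2) * (4 * 29 * (fact ?s * (Suc (2 ^ m) choose ?s)))"
      by (subst mult.commute) (intro mult_le_mono1, simp)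
    also have "\<dots> < (2 ^ m + 2) * (120 * (2 ^ m) ^ ?s)"
    proof -
      have "fact ?s * (Suc (2 ^ m) choose ?s) \<le> (2 ^ m) ^ ?s"
        using assms(1) by (intro fact_mult_binomial_Suc_le) auto
      moreover have "0 < ((2::nat) ^ m) ^ ?s" by simp
      ultimately have "4 * 29 * (fact ?s * (Suc (2 ^ m) choose ?s)) < 120 * (2 ^ m) ^ ?s"
        by linarith
      then show ?thesis by (intro mult_strict_left_mono) auto
    qed
    also have "120 * ((2::nat) ^ m) ^ ?s = 120 * 2 ^ (3 * m - 1) * 2 ^ (2 * m - 1)\<^sup>2"
    proof -
      obtain r where "m = Suc r" using assms(1) by (cases m) auto
      then have "m * ?s = (3 * m - 1) + (2 * m - 1)\<^sup>2"
        by (simp add: power2_eq_square algebra_simps)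
      then show ?thesis by (simp only: power_mult[symmetric] power_add mult.assoc)
    qed
    also have "(2 ^ m + 2) * (120 * 2 ^ (3 * m - 1) * 2 ^ (2 * m - 1)\<^sup>2)
        \<le> (2 ^ m + 2) * ((?s choose (2 * m)) * 2 ^ (2 * m - 1)\<^sup>2)"
      by (intro mult_le_mono2 mult_le_mono1 binomial_central_ge assms)
    finally show "4 * 29 * (fact ?s * (Suc (2 ^ m) choose ?s)) * (2 ^ m + 2 - ?s)
        < (2 ^ m + 2) * ((?s choose (2 * m)) * 2 ^ (2 * m - 1)\<^sup>2)" .
  qed (use assms M env_le_1_7 in auto)
qed

lemma sparse_orientable_double_small:
  assumes "m \<in> {4, 5, 6, 7, 8, 9}" "N \<le> 2 ^ m"
  shows "sparse_orientable N (2 * N) (4 * m - 2)"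
  using assms(1)
proof (elim insertE emptyE)
  assume m: "m = 4"
  have "15 choose 8 = (6435::nat)" by (simp add: binomial_fact' fact_numeral)
  then show ?thesis
    using sparse_orientable_double[of 4 N "5" 19580] assms(2) env_le_5
    by (simp add: m fact_mult_binomial_numeral choose_two)
next
  assume m: "m = 5"
  have "19 choose 10 = (92378::nat)" by (simp add: binomial_fact' fact_numeral)
  then show ?thesis
    using sparse_orientable_double[of 5 N "4 / 3" 372] assms(2) env_le_4_3
    by (simp add: m fact_mult_binomial_numeral choose_two)
next
  assume m: "m = 6"
  have "23 choose 12 = (1352078::nat)" by (simp add: binomial_fact' fact_numeral)
  then show ?thesis
    using sparse_orientable_double[of 6 N "3 / 5" 86] assms(2) env_le_3_5
    by (simp add: m fact_mult_binomial_numeral choose_two)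
next
  assume m: "m = 7"
  have "27 choose 14 = (20058300::nat)" by (simp add: binomial_fact' fact_numeral)
  then show ?thesis
    using sparse_orientable_double[of 7 N "3 / 5" 86] assms(2) env_le_3_5
    by (simp add: m fact_mult_binomial_numeral choose_two)
next
  assume m: "m = 8"
  have "31 choose 16 = (300540195::nat)" by (simp add: binomial_fact' fact_numeral)
  then show ?thesis
    using sparse_orientable_double[of 8 N "1 / 7" 29] assms(2) env_le_1_7
    by (simp add: m fact_mult_binomial_numeral choose_two)
next
  assume m: "m = 9"
  have "35 choose 18 = (4537567650::nat)" by (simp add: binomial_fact' fact_numeral)
  then show ?thesis
    using sparse_orientable_double[of 9 N "1 / 7" 29] assms(2) env_le_1_7
    by (simp add: m fact_mult_binomial_numeral choose_two)
qed

section \<open>Assembling the graphs\<close>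

text \<open>The smallest factor pairs with the added one:
  \<open>(N - 2 * m + 1) * (N + 2 * m) \<le> N * (N + 1)\<close>. Then
  \<open>(N + 1) * (N - 1) < N ^ 2\<close>, and the other factors are at most
  \<open>N\<close>.\<close>

lemma falling_factorial_mult_less:
  fixes m N :: nat
  assumes "m \<ge> 2" "2 * m \<le> N"
  shows "fact (2 * m) * (N choose (2 * m)) * (N + 2 * m) < N ^ (2 * m + 1)"
proof -
  obtain v where v: "2 * m = Suc (Suc (Suc v))"
    using assms(1) by (intro that[of "2 * m - 3"]) simp
  obtain K where K: "N = Suc K" using assms by (cases N) auto
  obtain u where u: "N = 2 * m + u" using assms(2) le_Suc_ex by blast
  have uN: "N - Suc (Suc v) = u + 1" using u v by simp
  have "fact (2 * m) * (N choose (2 * m)) = fact (Suc (Suc v)) * (Suc (Suc (Suc v)) * (N choose Suc (Suc (Suc v))))"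
    unfolding v fact_Suc[of "Suc (Suc v)"] by (simp only: of_nat_id mult_ac)
  also have "\<dots> = (u + 1) * (fact (Suc (Suc v)) * (N choose Suc (Suc v)))"
    unfolding binomial_absorption binomial_absorb_comp[symmetric] uN by (simp only: mult_ac)
  also have "\<dots> = (u + 1) * (N * ((K choose Suc v) * fact (Suc v)))"
    unfolding K fact_mult_binomial_absorb by (simp only: mult_ac)
  also have "\<dots> \<le> (u + 1) * (N * K ^ Suc v)"
    by (intro mult_le_mono2 binomial_fact_pow)
  finally have "fact (2 * m) * (N choose (2 * m)) * (N + 2 * m) \<le> (u + 1) * (N * K ^ Suc v) * (N + 2 * m)"
    by (rule mult_le_mono1)
  also have "\<dots> = ((u + 1) * (N + 2 * m)) * (N * K ^ Suc v)"
    by (simp only: mult_ac)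
  also have "\<dots> \<le> (N * (N + 1)) * (N * K ^ Suc v)"
  proof (intro mult_le_mono1)
    have "m \<le> m * m" by simp
    then show "(u + 1) * (N + 2 * m) \<le> N * (N + 1)"
      unfolding u by (simp add: algebra_simps)
  qed
  also have "\<dots> = (K * (N + 1)) * (N * N * K ^ v)"
    by (simp only: power_Suc mult_ac)
  also have "\<dots> \<le> (K * (N + 1)) * (N * N * N ^ v)"
    by (intro mult_le_mono2 power_mono) (simp_all add: K)
  also have "\<dots> < (N * N) * (N * N * N ^ v)"
    by (intro mult_strict_right_mono) (simp_all add: K)
  also have "\<dots> = N ^ (2 * m + 1)"
    by (simp add: v)
  finally show ?thesis .
qed

lemma sparse_orientable_clique_Suc:
  assumes "m \<ge> 2" "N \<le> 2 ^ m"
  shows "sparse_orientable N (Suc N) (2 * m)"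
proof (rule sparse_orientable_first_moment)
  obtain q where q: "2 * m = Suc q" using assms(1) by (cases "2 * m") auto
  let ?F = "\<Sum>S | S \<subseteq> {..<Suc N} \<and> card S = Suc (2 * m). \<Prod>v\<in>S. chain_ratio (card (nbrs_before N v \<inter> S))"
  have "?F \<le> real (N choose Suc (2 * m)) * chain_weight (Suc (2 * m))
        + real (N choose (2 * m)) * (chain_weight (2 * m) * chain_ratio q)"
    using sum_chain_ratio_clique_Suc_le[of N q] by (simp only: q)
  also have "\<dots> < 1"
  proof (cases "2 * m \<le> N")
    case False
    then show ?thesis by (simp add: binomial_eq_0)
  next
    case True
    have absorb: "real (N choose Suc (2 * m)) * (1 + real (2 * m)) = real (N choose (2 * m)) * (real N - real (2 * m))"
    proof -
      have "Suc (2 * m) * (N choose Suc (2 * m)) = (N - 2 * m) * (N choose (2 * m))"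
        by (simp only: binomial_absorption binomial_absorb_comp)
      from arg_cong[OF this, of real] show ?thesis
        using True by (simp add: of_nat_diff algebra_simps)
    qed
    have alg: "a * (w * ((1 + x) / z)) + b * (w * (2 * x / z)) = w / z * (a * (1 + x) + b * (2 * x))"
      for a b w x z :: real
      by (simp add: add_divide_distrib ring_distribs mult_ac)
    have ratio: "chain_ratio (2 * m) = (1 + real (2 * m)) / 2 ^ (2 * m)"
      by (simp add: chain_ratio_def)
    have ratio': "chain_ratio q = 2 * real (2 * m) / 2 ^ (2 * m)"
      unfolding chain_ratio_def q by (simp add: field_simps)
    \<comment> \<open>Over a common denominator the two terms combine by
      \<open>(N - 2 * m) + 2 * (2 * m) = N + 2 * m\<close>.\<close>
    have "real (N choose Suc (2 * m)) * chain_weight (Suc (2 * m))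
        + real (N choose (2 * m)) * (chain_weight (2 * m) * chain_ratio q)
      = chain_weight (2 * m) / 2 ^ (2 * m) * (real (N choose Suc (2 * m)) * (1 + real (2 * m))
          + real (N choose (2 * m)) * (2 * real (2 * m)))"
      unfolding chain_weight_Suc ratio ratio' by (rule alg)
    also have "\<dots> = real (fact (2 * m) * (N choose (2 * m)) * (N + 2 * m)) / 2 ^ (((2 * m) choose 2) + 2 * m)"
      unfolding absorb by (simp add: chain_weight_eq power_add field_simps)
    also have "((2 * m) choose 2) + 2 * m = m * (2 * m + 1)"
      by (cases m) (simp_all add: choose_two algebra_simps)
    also have "real (fact (2 * m) * (N choose (2 * m)) * (N + 2 * m)) / 2 ^ (m * (2 * m + 1)) < 1"
    proof -
      have "fact (2 * m) * (N choose (2 * m)) * (N + 2 * m) < N ^ (2 * m + 1)"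
        by (rule falling_factorial_mult_less[OF assms(1) True])
      also have "\<dots> \<le> (2 ^ m) ^ (2 * m + 1)" using assms(2) by (rule power_mono) simp
      also have "\<dots> = 2 ^ (m * (2 * m + 1))" by (simp only: power_mult)
      finally have "real (fact (2 * m) * (N choose (2 * m)) * (N + 2 * m)) < real (2 ^ (m * (2 * m + 1)))"
        by (rule of_nat_less_iff[THEN iffD2])
      then show ?thesis by simp
    qed
    finally show ?thesis .
  qed
  finally show "?F < 1" .
qed

text \<open>At \<open>N = 2 ^ m\<close> the expected numbers are \<open>24 / 2 ^ 6\<close> and
  \<open>28 * 720 / 2 ^ 15\<close>, so a single segment already works.\<close>

lemma sparse_orientable_clique_small:
  assumes "m \<in> {2, 3}" "N \<le> 2 ^ m"
  shows "sparse_orientable N N (2 * m - 1)"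
proof (rule sparse_orientable_first_moment)
  have m: "Suc (2 * m - 1) = 2 * m" using assms(1) by auto
  have "real (N choose (2 * m)) * chain_weight (2 * m) \<le> real (2 ^ m choose (2 * m)) * chain_weight (2 * m)"
    using chain_weight_pos[of "2 * m"] assms(2)
    by (intro mult_right_mono of_nat_mono binomial_right_mono) auto
  also have "\<dots> < 1"
    using assms(1) by (auto simp: chain_weight_eq choose_two binomial_fact' fact_numeral)
  finally show "(\<Sum>S | S \<subseteq> {..<N} \<and> card S = Suc (2 * m - 1).
      \<Prod>v\<in>S. chain_ratio (card (nbrs_before N v \<inter> S))) < 1"
    by (simp only: sum_chain_ratio_clique m)
qed

lemma sparse_orientable_pair:
  assumes "m \<ge> 2" "N \<le> 2 ^ m"
  shows "sparse_orientable N (2 * N) (2 * (2 * m - 1))"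
proof -
  consider "m \<in> {2, 3}" | "m \<in> {4, 5, 6, 7, 8, 9}" | "m \<ge> 10" using assms(1) by fastforce
  then show ?thesis
  proof cases
    case 1
    then show ?thesis
      by (intro sparse_orientable_mult sparse_orientable_clique_small assms)
  next
    case 2
    from sparse_orientable_double_small[OF this assms(2)] show ?thesis
      by (simp add: right_diff_distrib')
  next
    case 3
    from sparse_orientable_double_large[OF this assms(2)] show ?thesis
      by (simp add: right_diff_distrib')
  qed
qed

text \<open>Blocks are paired. For even \<open>n\<close> the extra vertex stands alone; for odd
  \<open>n\<close> it joins the unpaired block, whose bound \<open>2 * m\<close> is
  \<open>(2 * m - 1) + 1\<close>.\<close>

lemma sparse_orientable_blocks:
  assumes "m \<ge> 2" "N \<le> 2 ^ m"
  shows "sparse_orientable N (n * N + 1) (n * (2 * m - 1) + 1)"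
proof -
  have blocks: "sparse_orientable N (r * (2 * N)) (r * (2 * (2 * m - 1)))" for r
    by (intro sparse_orientable_mult sparse_orientable_pair assms)
  show ?thesis
  proof (cases "even n")
    case True
    then obtain r where n: "n = 2 * r" by blast
    show ?thesis
      using sparse_orientable_add[OF blocks[of r] sparse_orientable_trivial[of N 1]] by (simp add: n mult_ac)
  next
    case False
    then obtain r where n: "n = 2 * r + 1" using oddE by blast
    have "r * (2 * N) + Suc N = n * N + 1" by (simp add: n algebra_simps)
    moreover have "r * (2 * (2 * m - 1)) + 2 * m = n * (2 * m - 1) + 1"
      using assms(1) by (simp add: n add_mult_distrib mult_ac)
    ultimately show ?thesis
      using sparse_orientable_add[OF blocks[of r] sparse_orientable_clique_Suc[OF assms]] by simp
  qed
qed

section \<open>Treewidth, feedback vertex sets and the final family\<close>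

lemma treewidth_le_path_power:
  assumes "path_power_orientation (Suc k) n A"
  shows "treewidth_le k {..<n} A"
proof -
  \<comment> \<open>The whole \<open>k\<close>-th power of the path, in its natural order, is itself
    a \<open>k\<close>-tree.\<close>
  define E where "E = {(u, v). u < n \<and> v < n \<and> u \<noteq> v \<and> u < v + Suc k \<and> v < u + Suc k}"
  have "is_ktree k {..<n} E"
    unfolding is_ktree_def
  proof (intro conjI exI[of _ Suc] ballI)
    show "undirected_graph {..<n} E" by (auto simp: undirected_graph_def E_def)
    show "bij_betw Suc {..<n} {1..card {..<n}}"
      by (simp add: bij_betw_def image_Suc_lessThan)
    fix v assume "v \<in> {..<n}"
    \<comment> \<open>These are the \<open>min k v\<close> preceding vertices, by truncated
      subtraction; they are pairwise less than \<open>k\<close> apart and so form a clique.\<close>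
    then have P: "{u \<in> {..<n}. (u, v) \<in> E \<and> Suc u < Suc v} = {v - k..<v}"
      by (auto simp: E_def)
    show "let P = {u \<in> {..<n}. (u, v) \<in> E \<and> Suc u < Suc v}
          in (\<forall>x\<in>P. \<forall>y\<in>P. x \<noteq> y \<longrightarrow> (x, y) \<in> E) \<and> card P = min k (Suc v - 1)"
      unfolding P Let_def using \<open>v \<in> {..<n}\<close> by (auto simp: E_def)
  qed
  moreover have "underlying A \<subseteq> E"
    using assms unfolding path_power_orientation_def underlying_def E_def by blast
  ultimately show ?thesis unfolding treewidth_le_def by blast
qed

text \<open>The complement of a minimum feedback vertex set is acyclic, hence triangle-free.\<close>

lemma fvs_num_ge:
  assumes "finite V" and S: "\<And>S. S \<subseteq> V \<Longrightarrow> triangle_free A S \<Longrightarrow> card S \<le> t"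
  shows "card V \<le> fvs_num V A + t"
proof -
  have fin: "finite {F. is_fvs V A F}"
    by (rule finite_subset[of _ "Pow V"]) (use assms(1) in \<open>auto simp: is_fvs_def\<close>)
  have "is_fvs V A V" by (simp add: is_fvs_def acyclic_def)
  then have "fvs_num V A \<in> card ` {F. is_fvs V A F}"
    unfolding fvs_num_def using fin by (intro Min_in) auto
  then obtain F where F: "F \<subseteq> V" "acyclic (A \<inter> (V - F) \<times> (V - F))" "fvs_num V A = card F"
    unfolding is_fvs_def by auto
  have "card (V - F) \<le> t"
    by (intro S acyclic_imp_triangle_free F) auto
  moreover have "card V = card F + card (V - F)"
    using F(1) assms(1) by (metis card_Diff_subset card_mono finite_subset le_add_diff_inverse)
  ultimately show ?thesis using F(3) by simp
qed

theorem mainTheorem8: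
  fixes k :: nat
  assumes "k \<ge> 2"
  shows "\<exists>V :: nat \<Rightarrow> nat set. \<exists>A :: nat \<Rightarrow> (nat \<times> nat) set.
           \<forall>i :: nat. oriented_graph (V i) (A i) \<and> treewidth_le k (V i) (A i)
             \<and> card (V i) = k + 2 + i * (k + 1)
             \<and> int (fvs_num (V i) (A i)) \<ge> int (i + 1) * (int k - 2 * \<lfloor>log 2 (real k)\<rfloor>)"
proof -
  obtain l where l: "2 ^ l \<le> k" "k < 2 ^ (l + 1)"
    using ex_power_ivl1[of 2 k] assms by auto
  have log: "\<lfloor>log 2 (real k)\<rfloor> = int l"
    using floor_log_nat_eq_powr_iff[of 2 k l] l assms by simp
  have "l \<noteq> 0" using l assms by (intro notI) simp
  then have m: "l + 1 \<ge> 2" "Suc k \<le> 2 ^ (l + 1)" using l by auto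
  \<comment> \<open>\<open>n i = (i + 1) * (k + 1) + 1\<close> and
    \<open>t i = (i + 1) * (2 * l + 1) + 1\<close>: the extra ones cancel, leaving
    \<open>(i + 1) * (k - 2 * l)\<close>.\<close>
  define n where "n i = k + 2 + i * (k + 1)" for i
  define t where "t i = (i + 1) * (2 * (l + 1) - 1) + 1" for i
  have "n i = (i + 1) * Suc k + 1" for i by (simp add: n_def)
  then have "sparse_orientable (Suc k) (n i) (t i)" for i
    using sparse_orientable_blocks[OF m, of "i + 1"] by (simp only: t_def)
  then have "\<forall>i. \<exists>A. path_power_orientation (Suc k) (n i) A \<and>
      (\<forall>S. S \<subseteq> {..<n i} \<and> triangle_free A S \<longrightarrow> card S \<le> t i)"
    unfolding sparse_orientable_def by blast
  then obtain A where A: "\<And>i. path_power_orientation (Suc k) (n i) (A i)"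
      "\<And>i S. S \<subseteq> {..<n i} \<Longrightarrow> triangle_free (A i) S \<Longrightarrow> card S \<le> t i"
    by metis
  show ?thesis
  proof (rule exI[of _ "\<lambda>i. {..<n i}"], rule exI[of _ A], intro allI conjI)
    fix i
    show "oriented_graph {..<n i} (A i)"
      using A(1)[of i] unfolding oriented_graph_def path_power_orientation_def by auto
    show "treewidth_le k {..<n i} (A i)" by (rule treewidth_le_path_power[OF A(1)])
    show "card {..<n i} = k + 2 + i * (k + 1)" by (simp add: n_def)
    have "n i \<le> fvs_num {..<n i} (A i) + t i"
      using fvs_num_ge[of "{..<n i}" "A i" "t i"] A(2) by simp
    then have "int (n i) \<le> int (fvs_num {..<n i} (A i)) + int (t i)" by linarith
    then show "int (fvs_num {..<n i} (A i)) \<ge> int (i + 1) * (int k - 2 * \<lfloor>log 2 (real k)\<rfloor>)"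
      by (simp add: log n_def t_def algebra_simps)
  qed
qed

end
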